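(* Let $\mathcal{S}=(E,\mathfrak{B})$ be a Steiner system of type $S(t,k,n)$ with $1\le t<k<n$, and let $M(\mathcal{S})$ be the matroid of rank $k$ on $E$ whose bases are the $k$-element subsets of $E$ that are not blocks of $\mathcal{S}$. Then $$\widehat{\rho}(I(M(\mathcal{S})))=\frac{\alpha(I(M(\mathcal{S})))}{\widehat{\alpha}(I(M(\mathcal{S})))}=\frac{k(n-k)}{n}=\frac{\alpha(I_{\Delta(M(\mathcal{S})^* )})}{\widehat{\alpha}(I_{\Delta(M(\mathcal{S})^* )})}=\widehat{\rho}(I_{\Delta(M(\mathcal{S})^* )}).$$
   Context: A Steiner system of type $S(t,k,n)$ is a pair $\mathcal{S}=(E,\mathfrak{B})$ where $E$ is a set of cardinality $n$ and $\mathfrak{B}$ is a collection of $k$-element subsets of $E$ (the blocks) such that every $t$-element subset of $E$ is contained in a unique block. It is assumed throughout that $1\le t<k<n$; under this assumption the $k$-subsets of $E$ that are not blocks form the bases of a matroid $M(\mathcal{S})$. Let $\mathbb{K}$ be a field, $S=\mathbb{K}[x_e : e\in E]$ the standard graded polynomial ring, and $x^U=\prod_{i\in U}x_i$ for $U\subseteq E$. For a squarefree monomial ideal $I\subseteq S$ and $s\ge 1$, the $s$-th symbolic power is $I^{(s)}=\bigcap_{P\in \mathrm{Min}(I)}P^s$, where $\mathrm{Min}(I)$ is the set of minimal primes of $I$. For a nonzero homogeneous ideal $I$, $\alpha(I)$ is the smallest degree of a nonzero homogeneous element of $I$; the Waldschmidt constant is $\widehat{\alpha}(I)=\lim_{s\to\infty}\alpha(I^{(s)})/s$.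 The asymptotic resurgence is $\widehat{\rho}(I)=\sup\{ s/r : s,r \text{ positive integers and } I^{(st)}\not\subseteq I^{rt}\text{ for all } t\gg 0\}$. For a matroid $M$ on $E$ with set of bases $\mathcal{B}(M)$ and set of circuits $\mathcal{C}(M)$, the facet ideal is $I(M)=\langle x^B : B\in\mathcal{B}(M)\rangle$, and the Stanley-Reisner ideal is $I_{\Delta(M)}=\langle x^C : C\in\mathcal{C}(M)\rangle$. The dual matroid $M^*$ has bases $\{E\setminus B : B\in\mathcal{B}(M)\}$. *)

theory Defs
  imports Complex_Main "HOL-Library.Poly_Mapping" "HOL-Algebra.Ideal_Product"
begin

definition steiner_system :: "nat \<Rightarrow> nat \<Rightarrow> nat \<Rightarrow> 'e set \<Rightarrow> 'e set set \<Rightarrow> bool" where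
  "steiner_system t k n E Bl \<longleftrightarrow>
     finite E \<and> card E = n \<and>
     (\<forall>B\<in>Bl. B \<subseteq> E \<and> card B = k) \<and>
     (\<forall>T. T \<subseteq> E \<and> card T = t \<longrightarrow> (\<exists>!B. B \<in> Bl \<and> T \<subseteq> B))"

record 'e matroid_data =
  ground :: "'e set"
  bases :: "'e set set"

locale matroid =
  fixes M :: "'e matroid_data"
  assumes finite_ground: "finite (ground M)"
    and bases_subset: "B \<in> bases M \<Longrightarrow> B \<subseteq> ground M"
    and bases_nonempty: "bases M \<noteq> {}"
    and exchange: "\<lbrakk> B \<in> bases M; B' \<in> bases M; x \<in> B - B' \<rbrakk>
                     \<Longrightarrow> \<exists>y\<in>B' - B. insert y (B - {x}) \<in> bases M"

definition indep :: "'e matroid_data \<Rightarrow> 'e set \<Rightarrow> bool" where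
  "indep M X \<longleftrightarrow> (\<exists>B\<in>bases M. X \<subseteq> B)"

definition circuits :: "'e matroid_data \<Rightarrow> 'e set set" where
  "circuits M = {C. C \<subseteq> ground M \<and> \<not> indep M C \<and> (\<forall>D. D \<subset> C \<longrightarrow> indep M D)}"

definition dual_matroid :: "'e matroid_data \<Rightarrow> 'e matroid_data" where
  "dual_matroid M = \<lparr> ground = ground M, bases = {ground M - B | B. B \<in> bases M} \<rparr>"

text \<open>See \<open>matroid_steiner_matroid\<close> below for the matroid axioms.\<close>

definition steiner_matroid :: "nat \<Rightarrow> 'e set \<Rightarrow> 'e set set \<Rightarrow> 'e matroid_data" where
  "steiner_matroid k E Bl =
     \<lparr> ground = E, bases = {B. B \<subseteq> E \<and> card B = k \<and> B \<notin> Bl} \<rparr>"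

text \<open>
  A monomial is a finitely supported exponent vector and a polynomial is a finitely supported
  family of coefficients indexed by monomials; the product on
  \<^typ>\<open>('e \<Rightarrow>\<^sub>0 nat) \<Rightarrow>\<^sub>0 'k::comm_ring_1\<close> is the convolution product, that is, the
  usual multiplication of polynomials.
\<close>

type_synonym ('e, 'k) mpoly = "('e \<Rightarrow>\<^sub>0 nat) \<Rightarrow>\<^sub>0 'k"

text \<open>
  The first argument only serves to name the coefficient field.
\<close>

definition poly_ring :: "'k::field itself \<Rightarrow> 'e set \<Rightarrow> ('e, 'k) mpoly ring" where
  "poly_ring K E =
     \<lparr> carrier = {p. \<forall>m\<in>Poly_Mapping.keys p. Poly_Mapping.keys m \<subseteq> E},
       mult = (*), one = 1, zero = 0, add = (+) \<rparr>"

definition var :: "'e \<Rightarrow> ('e, 'k::field) mpoly" where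
  "var i = Poly_Mapping.single (Poly_Mapping.single i 1) 1"

definition sqfree_monom :: "'e set \<Rightarrow> ('e, 'k::field) mpoly" where
  "sqfree_monom U = (\<Prod>i\<in>U. var i)"

definition monom_deg :: "('e \<Rightarrow>\<^sub>0 nat) \<Rightarrow> nat" where
  "monom_deg m = (\<Sum>i\<in>Poly_Mapping.keys m. Poly_Mapping.lookup m i)"

definition homogeneous_of_degree :: "nat \<Rightarrow> ('e, 'k::field) mpoly \<Rightarrow> bool" where
  "homogeneous_of_degree d p \<longleftrightarrow> (\<forall>m\<in>Poly_Mapping.keys p. monom_deg m = d)"

definition minimal_primes :: "('a, 'b) ring_scheme \<Rightarrow> 'a set \<Rightarrow> 'a set set" where
  "minimal_primes R I =
     {P. primeideal P R \<and> I \<subseteq> P \<and> (\<forall>Q. primeideal Q R \<and> I \<subseteq> Q \<and> Q \<subseteq> P \<longrightarrow> Q = P)}"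

abbreviation ideal_power :: "('a, 'b) ring_scheme \<Rightarrow> 'a set \<Rightarrow> nat \<Rightarrow> 'a set" where
  "ideal_power R I s \<equiv> I [^]\<^bsub>ideals_set R\<^esub> s"

text \<open>
  This is the right notion for radical ideals; it is only used for squarefree monomial ideals.
  The intersection is formed inside \<open>R\<close>, which matters only if \<open>I\<close> has no minimal primes.
\<close>

definition symbolic_power :: "('a, 'b) ring_scheme \<Rightarrow> 'a set \<Rightarrow> nat \<Rightarrow> 'a set" where
  "symbolic_power R I s = carrier R \<inter> (\<Inter>P\<in>minimal_primes R I. ideal_power R P s)"

definition initial_degree :: "('e, 'k::field) mpoly set \<Rightarrow> nat" where
  "initial_degree I = (LEAST d. \<exists>f\<in>I. f \<noteq> 0 \<and> homogeneous_of_degree d f)"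

definition waldschmidt ::
    "('e, 'k::field) mpoly ring \<Rightarrow> ('e, 'k) mpoly set \<Rightarrow> real" where
  "waldschmidt R I = lim (\<lambda>s. real (initial_degree (symbolic_power R I s)) / real s)"

definition asymptotic_resurgence :: "('a, 'b) ring_scheme \<Rightarrow> 'a set \<Rightarrow> real" where
  "asymptotic_resurgence R I =
     Sup {real s / real r | s r. s > 0 \<and> r > 0 \<and>
            (\<forall>\<^sub>F t in sequentially. \<not> symbolic_power R I (s * t) \<subseteq> ideal_power R I (r * t))}"

definition facet_ideal ::
    "'k::field itself \<Rightarrow> 'e matroid_data \<Rightarrow> ('e, 'k) mpoly set" where
  "facet_ideal K M = Idl\<^bsub>poly_ring K (ground M)\<^esub> (sqfree_monom ` bases M)"

definition stanley_reisner_ideal ::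
    "'k::field itself \<Rightarrow> 'e matroid_data \<Rightarrow> ('e, 'k) mpoly set" where
  "stanley_reisner_ideal K M = Idl\<^bsub>poly_ring K (ground M)\<^esub> (sqfree_monom ` circuits M)"

lemma cring_poly_ring: "cring (poly_ring K E)"
proof (rule cringI)
  show "abelian_group (poly_ring K E)"
  proof (rule abelian_groupI)
    fix x assume x: "x \<in> carrier (poly_ring K E)"
    show "\<exists>y\<in>carrier (poly_ring K E). y \<oplus>\<^bsub>poly_ring K E\<^esub> x = \<zero>\<^bsub>poly_ring K E\<^esub>"
    proof
      show "- x \<in> carrier (poly_ring K E)"
        using x by (auto simp: poly_ring_def in_keys_iff)
    qed (simp add: poly_ring_def)
  next
    fix x y
    assume "x \<in> carrier (poly_ring K E)" "y \<in> carrier (poly_ring K E)"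
    then show "x \<oplus>\<^bsub>poly_ring K E\<^esub> y \<in> carrier (poly_ring K E)"
      using Poly_Mapping.keys_add[of x y] unfolding poly_ring_def by auto
  qed (simp_all add: poly_ring_def add_ac)
  show "Group.comm_monoid (poly_ring K E)"
  proof (rule comm_monoidI)
    fix x y
    assume xy: "x \<in> carrier (poly_ring K E)" "y \<in> carrier (poly_ring K E)"
    have "Poly_Mapping.keys m \<subseteq> E" if m: "m \<in> Poly_Mapping.keys (x * y)" for m
    proof -
      obtain a b where "m = a + b" "a \<in> Poly_Mapping.keys x" "b \<in> Poly_Mapping.keys y"
        using m Poly_Mapping.keys_mult[of x y] by blast
      then show ?thesis
        using xy Poly_Mapping.keys_add[of a b] by (fastforce simp: poly_ring_def)
    qed
    then show "x \<otimes>\<^bsub>poly_ring K E\<^esub> y \<in> carrier (poly_ring K E)"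
      by (simp add: poly_ring_def)
  qed (simp_all add: poly_ring_def mult_ac)
qed (simp add: poly_ring_def distrib_right)

lemma matroid_steiner_matroid:
  assumes S: "steiner_system t k n E Bl" and tk: "t < k" and kn: "k < n"
  shows "matroid (steiner_matroid k E Bl)"
proof -
  have fin: "finite E" and cE: "card E = n"
    using S by (auto simp: steiner_system_def)
  have two_blocks: "B = B'" if "B \<in> Bl" "B' \<in> Bl" "X \<subseteq> B" "X \<subseteq> B'" and cX: "k \<le> Suc (card X)" for B B' X
  proof -
    have "X \<subseteq> E" using that S by (auto simp: steiner_system_def)
    moreover obtain T where T: "T \<subseteq> X" "card T = t"
      using cX tk obtain_subset_with_card_n[of t X] by auto
    ultimately have "T \<subseteq> E" by blast
    then have "\<exists>!B. B \<in> Bl \<and> T \<subseteq> B"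
      using S T(2) by (simp add: steiner_system_def)
    moreover have "T \<subseteq> B" "T \<subseteq> B'" using that T by auto
    ultimately show ?thesis using that(1,2) by (metis (no_types))
  qed
  show ?thesis
  proof
    show "finite (ground (steiner_matroid k E Bl))"
      using fin by (simp add: steiner_matroid_def)
    show "B \<subseteq> ground (steiner_matroid k E Bl)" if "B \<in> bases (steiner_matroid k E Bl)" for B
      using that by (simp add: steiner_matroid_def)
    have "\<exists>B. B \<subseteq> E \<and> card B = k \<and> B \<notin> Bl"
    proof (rule ccontr)
      assume *: "\<not> ?thesis"
      obtain T where T: "T \<subseteq> E" "card T = Suc k" "finite T"
        using kn cE obtain_subset_with_card_n[of "Suc k" E] by auto
      then obtain x where x: "x \<in> T" by fastforce
      have "card (T - {x}) = k" using T x by simp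
      then have "T - {x} \<noteq> {}" using tk by (metis card.empty not_less0)
      then obtain y where y: "y \<in> T - {x}" by blast
      have "T - {z} \<in> Bl" if z: "z \<in> T" for z
      proof -
        have "T - {z} \<subseteq> E" "card (T - {z}) = k" using T z by auto
        then show ?thesis using * by blast
      qed
      then have "T - {x} \<in> Bl" "T - {y} \<in> Bl" using x y by auto
      moreover have "card (T - {x,y}) = k - 1"
      proof -
        have "card {x,y} = 2" using y by auto
        then show ?thesis using T x y by (simp add: card_Diff_subset)
      qed
      ultimately have "T - {x} = T - {y}"
        by (intro two_blocks[of _ _ "T - {x,y}"]) auto
      then show False using x y by blast
    qed
    then show "bases (steiner_matroid k E Bl) \<noteq> {}"
      by (auto simp: steiner_matroid_def)
  next
    fix B B' x
    assume B: "B \<in> bases (steiner_matroid k E Bl)" and B': "B' \<in> bases (steiner_matroid k E Bl)"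
      and x: "x \<in> B - B'"
    have B1: "B \<subseteq> E" "card B = k" "finite B" and B2: "B' \<subseteq> E" "card B' = k" "B' \<notin> Bl" "finite B'"
      using B B' fin by (auto simp: steiner_matroid_def dest: finite_subset)
    have cx: "card (B - {x}) = k - 1" using B1 x by simp
    have ins: "insert y (B - {x}) \<subseteq> E \<and> card (insert y (B - {x})) = k" if "y \<in> B' - B" for y
      using that B1 B2 cx tk by (auto simp: card_insert_if)
    have "\<exists>y\<in>B' - B. insert y (B - {x}) \<notin> Bl"
    proof (rule ccontr)
      assume "\<not> ?thesis"
      then have bl: "insert y (B - {x}) \<in> Bl" if "y \<in> B' - B" for y using that by blast
      have "\<not> B' \<subseteq> B" using B1 B2 x card_subset_eq[of B B'] by blast
      then obtain y where y: "y \<in> B' - B" by blast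
      have uniq: "z = y" if "z \<in> B' - B" for z
      proof -
        have "insert z (B - {x}) = insert y (B - {x})"
          using cx by (intro two_blocks[OF bl[OF that] bl[OF y], of "B - {x}"]) auto
        then show ?thesis using that y by blast
      qed
      then have "B' \<subseteq> insert y (B - {x})" using x by blast
      then have "B' = insert y (B - {x})"
        using ins[OF y] B1 B2 card_subset_eq by (metis finite.insertI finite_Diff)
      then show False using bl[OF y] B2 by simp
    qed
    then show "\<exists>y\<in>B' - B. insert y (B - {x}) \<in> bases (steiner_matroid k E Bl)"
      using ins by (auto simp: steiner_matroid_def)
  qed
qed

end

theory Submission
  imports Defs
begin

text \<open>
  Write \<open>m = n - k\<close>. The minimal primes of the ideal of a clutter correspond to its blocker, and
  the blocker of the bases of \<open>M\<close> consists of the cocircuits of \<open>M\<close>, whose monomials generate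
  the Stanley--Reisner ideal of the dual, and vice versa. So both ideals are treated alike once the
  following width--length inequality is known:
  if \<open>y\<close>, \<open>z \<ge> 0\<close> have weight at least \<open>1\<close> on every cocircuit and on every basis respectively, then
  \<open>\<Sum>\<^sub>e y\<^sub>e z\<^sub>e \<ge> n / (k m)\<close>. Constant exponent vectors give the upper bound for the Waldschmidt
  constant and the lower bound for the resurgence; constant \<open>z\<close> gives the lower bound for the
  Waldschmidt constant. By linear programming duality, the inequality says that an exponent vector
  of \<open>I\<^bsup>(s)\<^esup>\<close> dominates a fractional packing of generators of total weight \<open>s n / (k m)\<close>; rounding
  down loses at most the number of generators, which is negligible asymptotically.

  For the inequality, sort \<open>E\<close> by \<open>z\<close> and compare \<open>y\<close> by Abel summation with a greedy basis. This
  needs \<open>y(E - F) \<ge> (k - j) n / (k m)\<close> for every \<open>j\<close>-subset \<open>F\<close> with \<open>j < k\<close>. If \<open>j < t\<close>, average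
  over the blocks through \<open>F\<close>, which form a design on \<open>E - F\<close>. If \<open>j \<ge> t\<close>, at most one block
  contains \<open>F\<close>; enlarge \<open>F\<close> by the \<open>k - 1 - j\<close> heaviest elements outside \<open>F\<close> and this block,
  and use that the complement of a \<open>(k-1)\<close>-subset contains a cocircuit.
\<close>

section \<open>Monomial ideals\<close>

lemma poly_ring_simps [simp]:
  "p \<in> carrier (poly_ring K E) \<longleftrightarrow> (\<forall>m\<in>Poly_Mapping.keys p. Poly_Mapping.keys m \<subseteq> E)"
  "mult (poly_ring K E) = (*)"
  "one (poly_ring K E) = 1"
  "zero (poly_ring K E) = 0"
  "add (poly_ring K E) = (+)"
  by (simp_all add: poly_ring_def)

text \<open>The span of the monomials with exponent vector in \<open>U\<close> and support in
  \<open>E\<close>; it is an ideal once \<open>U\<close> is closed under adding exponent vectors.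
  With \<open>U\<close> arbitrary, generation, products and intersections all turn into conditions
  on exponent vectors.\<close>

definition monomial_ideal :: "'e set \<Rightarrow> ('e \<Rightarrow>\<^sub>0 nat) set \<Rightarrow> ('e, 'k::field) mpoly set" where
  "monomial_ideal E U = {p. \<forall>m\<in>Poly_Mapping.keys p. Poly_Mapping.keys m \<subseteq> E \<and> m \<in> U}"

lemma monomial_ideal_mono: "U \<subseteq> V \<Longrightarrow> monomial_ideal E U \<subseteq> monomial_ideal E V"
  by (auto simp: monomial_ideal_def)

lemma single_mem_monomial_ideal_iff:
  "Poly_Mapping.single m (1 :: 'k::field) \<in> monomial_ideal E U \<longleftrightarrow> Poly_Mapping.keys m \<subseteq> E \<and> m \<in> U"
  by (simp add: monomial_ideal_def)

definition indicator_monom :: "'e set \<Rightarrow> ('e \<Rightarrow>\<^sub>0 nat)" where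
  "indicator_monom A = (\<Sum>e\<in>A. Poly_Mapping.single e 1)"

lemma lookup_indicator_monom:
  assumes "finite A"
  shows "Poly_Mapping.lookup (indicator_monom A) e = (if e \<in> A then 1 else 0)"
  using assms by (simp add: indicator_monom_def lookup_sum lookup_single when_def)

lemma keys_indicator_monom: "finite A \<Longrightarrow> Poly_Mapping.keys (indicator_monom A) = A"
  by (auto simp: in_keys_iff lookup_indicator_monom split: if_splits)

lemma sqfree_monom_eq_single:
  assumes "finite A"
  shows "(sqfree_monom A :: ('e, 'k::field) mpoly) = Poly_Mapping.single (indicator_monom A) 1"
  using assms unfolding sqfree_monom_def indicator_monom_def
  by (induction A rule: finite_induct) (simp_all add: var_def mult_single)

lemma keys_add_nat:
  "Poly_Mapping.keys (u + v) = Poly_Mapping.keys u \<union> Poly_Mapping.keys (v :: 'e \<Rightarrow>\<^sub>0 nat)"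
  by (auto simp: in_keys_iff lookup_add)

lemma add_diff_monom:
  fixes u m :: "'e \<Rightarrow>\<^sub>0 nat"
  assumes "\<And>e. Poly_Mapping.lookup u e \<le> Poly_Mapping.lookup m e"
  shows "(m - u) + u = m"
  by (rule poly_mapping_eqI) (simp add: lookup_add lookup_minus assms)

lemma keys_minus_eq: "Poly_Mapping.keys (- p) = Poly_Mapping.keys (p :: 'a \<Rightarrow>\<^sub>0 'b::ab_group_add)"
  by (auto simp: in_keys_iff)

text \<open>Closure under negation comes from multiplication by the constant
  \<open>-1\<close>.\<close>

lemma poly_ring_idealI:
  fixes J :: "('e, 'k::field) mpoly set"
  assumes sub: "J \<subseteq> carrier (poly_ring K E)" and "0 \<in> J"
    and add: "\<And>x y. x \<in> J \<Longrightarrow> y \<in> J \<Longrightarrow> x + y \<in> J"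
    and mult: "\<And>x y. x \<in> carrier (poly_ring K E) \<Longrightarrow> y \<in> J \<Longrightarrow> x * y \<in> J"
  shows "ideal J (poly_ring K E)"
proof -
  interpret cring "poly_ring K E" by (rule cring_poly_ring)
  show ?thesis
  proof (rule idealI)
    show "ring (poly_ring K E)" by (rule ring_axioms)
    show "subgroup J (add_monoid (poly_ring K E))"
    proof (rule add.subgroupI)
      show "J \<subseteq> carrier (poly_ring K E)" "J \<noteq> {}" using sub \<open>0 \<in> J\<close> by auto
    next
      fix a assume a: "a \<in> J"
      have m1: "(-1 :: ('e, 'k) mpoly) \<in> carrier (poly_ring K E)" by simp
      have "- 1 * a \<in> J" by (rule mult[OF m1 a])
      moreover have "\<ominus>\<^bsub>poly_ring K E\<^esub> a = - a"
      proof (rule minus_equality)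
        show "- a \<oplus>\<^bsub>poly_ring K E\<^esub> a = \<zero>\<^bsub>poly_ring K E\<^esub>" by simp
        show "a \<in> carrier (poly_ring K E)" "- a \<in> carrier (poly_ring K E)"
          using subsetD[OF sub a] by (simp_all only: poly_ring_simps keys_minus_eq)
      qed
      ultimately show "\<ominus>\<^bsub>poly_ring K E\<^esub> a \<in> J" by simp
    next
      fix a b assume "a \<in> J" "b \<in> J"
      then show "a \<oplus>\<^bsub>poly_ring K E\<^esub> b \<in> J" using add by simp
    qed
  next
    fix a x assume a: "a \<in> J" and x: "x \<in> carrier (poly_ring K E)"
    show "x \<otimes>\<^bsub>poly_ring K E\<^esub> a \<in> J" using mult[OF x a] by simp
    then show "a \<otimes>\<^bsub>poly_ring K E\<^esub> x \<in> J" by (simp add: mult.commute)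
  qed
qed

lemma ideal_monomial_ideal:
  fixes U :: "('e \<Rightarrow>\<^sub>0 nat) set"
  assumes up: "\<And>u v. u \<in> U \<Longrightarrow> v + u \<in> U"
  shows "ideal (monomial_ideal E U :: ('e, 'k::field) mpoly set) (poly_ring (K :: 'k itself) E)"
proof (rule poly_ring_idealI)
  fix x y :: "('e, 'k) mpoly"
  assume x: "x \<in> carrier (poly_ring K E)" and y: "y \<in> monomial_ideal E U"
  show "x * y \<in> monomial_ideal E U"
    unfolding monomial_ideal_def
  proof (intro CollectI ballI)
    fix m assume "m \<in> Poly_Mapping.keys (x * y)"
    then obtain a b where "m = a + b" "a \<in> Poly_Mapping.keys x" "b \<in> Poly_Mapping.keys y"
      using Poly_Mapping.keys_mult[of x y] by blast
    then show "Poly_Mapping.keys m \<subseteq> E \<and> m \<in> U"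
      using x y up by (auto simp: monomial_ideal_def keys_add_nat)
  qed
next
  fix x y :: "('e, 'k) mpoly"
  assume "x \<in> monomial_ideal E U" "y \<in> monomial_ideal E U"
  then show "x + y \<in> monomial_ideal E U"
    using Poly_Mapping.keys_add[of x y] unfolding monomial_ideal_def by blast
qed (auto simp: monomial_ideal_def)

lemma sum_single_lookup:
  "(\<Sum>m\<in>Poly_Mapping.keys p. Poly_Mapping.single m (Poly_Mapping.lookup p m)) = p"
  by (rule poly_mapping_eqI)
     (auto simp: lookup_sum lookup_single when_def in_keys_iff)

text \<open>A polynomial is a combination of its monomials, and \<open>J\<close> absorbs the
  constant coefficients. This reduces inclusions between ideals to monomials with coefficient
  \<open>1\<close>.\<close>

lemma mem_ideal_if_monomials:
  fixes p :: "('e, 'k::field) mpoly"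
  assumes J: "ideal J (poly_ring (K :: 'k itself) E)"
    and mon: "\<And>m. m \<in> Poly_Mapping.keys p \<Longrightarrow> Poly_Mapping.single m 1 \<in> J"
  shows "p \<in> J"
proof -
  interpret ideal J "poly_ring K E" by (rule J)
  have scaled: "Poly_Mapping.single m c \<in> J" if "m \<in> Poly_Mapping.keys p" for m c
  proof -
    have "Poly_Mapping.single 0 c \<otimes>\<^bsub>poly_ring K E\<^esub> Poly_Mapping.single m 1 \<in> J"
      by (rule I_l_closed) (use mon[OF that] in auto)
    then show ?thesis by (simp add: mult_single)
  qed
  have "(\<Sum>m\<in>X. Poly_Mapping.single m (Poly_Mapping.lookup p m)) \<in> J"
    if "finite X" "X \<subseteq> Poly_Mapping.keys p" for X
    using that
  proof (induction X rule: finite_induct)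
    case empty
    then show ?case using additive_subgroup.zero_closed[OF additive_subgroup_axioms] by simp
  next
    case (insert m X)
    then show ?case using additive_subgroup.a_closed[OF additive_subgroup_axioms scaled, of m] by simp
  qed
  from this[of "Poly_Mapping.keys p"] show ?thesis by (simp add: sum_single_lookup)
qed

text \<open>Divisibility by a squarefree monomial depends only on the support, so the generated
  ideal consists of the polynomials all of whose monomials have a member of \<open>\<A>\<close> in
  their support.\<close>

lemma genideal_sqfree_monom:
  fixes K :: "'k::field itself" and \<A> :: "'e set set"
  assumes fin: "finite E" and sub: "\<A> \<subseteq> Pow E"
  shows "Idl\<^bsub>poly_ring K E\<^esub> (sqfree_monom ` \<A>) =
         monomial_ideal E {m. \<exists>A\<in>\<A>. A \<subseteq> Poly_Mapping.keys m}" (is "?L = ?R")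
proof
  interpret cring "poly_ring K E" by (rule cring_poly_ring)
  have finA: "finite A" if "A \<in> \<A>" for A using that fin sub finite_subset by blast
  have carr: "sqfree_monom ` \<A> \<subseteq> carrier (poly_ring K E)"
    using finA sub by (fastforce simp: sqfree_monom_eq_single keys_indicator_monom)
  show "?L \<subseteq> ?R"
  proof (rule genideal_minimal)
    show "ideal ?R (poly_ring K E)"
      by (rule ideal_monomial_ideal) (auto simp: keys_add_nat)
    show "sqfree_monom ` \<A> \<subseteq> ?R"
      using finA sub by (fastforce simp: monomial_ideal_def sqfree_monom_eq_single keys_indicator_monom)
  qed
  show "?R \<subseteq> ?L"
  proof
    fix p :: "('e, 'k) mpoly" assume p: "p \<in> ?R"
    have id: "ideal ?L (poly_ring K E)" by (rule genideal_ideal[OF carr])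
    show "p \<in> ?L"
    proof (rule mem_ideal_if_monomials[OF id])
      fix m assume "m \<in> Poly_Mapping.keys p"
      with p obtain A where m: "Poly_Mapping.keys m \<subseteq> E" and A: "A \<in> \<A>" "A \<subseteq> Poly_Mapping.keys m"
        by (auto simp: monomial_ideal_def)
      have eq: "(m - indicator_monom A) + indicator_monom A = m"
        using A finA by (intro add_diff_monom) (auto simp: lookup_indicator_monom in_keys_iff Suc_le_eq)
      have "Poly_Mapping.single (m - indicator_monom A) 1 \<otimes>\<^bsub>poly_ring K E\<^esub> sqfree_monom A \<in> ?L"
      proof (rule ideal.I_l_closed[OF id])
        show "sqfree_monom A \<in> ?L" using genideal_self[OF carr] A by blast
        have "Poly_Mapping.keys (m - indicator_monom A) \<subseteq> Poly_Mapping.keys m"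
          by (auto simp: in_keys_iff lookup_minus)
        then show "Poly_Mapping.single (m - indicator_monom A) 1 \<in> carrier (poly_ring K E)"
          using m by auto
      qed
      then show "Poly_Mapping.single m 1 \<in> ?L"
        using A finA by (simp add: sqfree_monom_eq_single mult_single eq)
    qed
  qed
qed

section \<open>Products and powers of squarefree monomial ideals\<close>

lemma ideal_prod_monomial_ideal:
  fixes K :: "'k::field itself" and U V :: "('e \<Rightarrow>\<^sub>0 nat) set"
  assumes "\<And>u v. u \<in> U \<Longrightarrow> v + u \<in> U" and "\<And>u v. u \<in> V \<Longrightarrow> v + u \<in> V"
  shows "ideal_prod (poly_ring K E) (monomial_ideal E U) (monomial_ideal E V) =
         monomial_ideal E {m. \<exists>u\<in>U. \<exists>v\<in>V. m = u + v}" (is "?L = ?R")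
proof
  interpret cring "poly_ring K E" by (rule cring_poly_ring)
  show "?L \<subseteq> ?R"
  proof
    fix p assume "p \<in> ?L"
    then show "p \<in> ?R"
    proof (induction rule: ideal_prod.induct)
      case (prod x y)
      show ?case
        unfolding monomial_ideal_def
      proof (intro CollectI ballI)
        fix m assume "m \<in> Poly_Mapping.keys (x \<otimes>\<^bsub>poly_ring K E\<^esub> y)"
        then obtain a b where "m = a + b" "a \<in> Poly_Mapping.keys x" "b \<in> Poly_Mapping.keys y"
          using Poly_Mapping.keys_mult[of x y] by auto
        then show "Poly_Mapping.keys m \<subseteq> E \<and> m \<in> {m. \<exists>u\<in>U. \<exists>v\<in>V. m = u + v}"
          using prod unfolding monomial_ideal_def by (simp add: keys_add_nat) blast
      qed
    next
      case (sum x y)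
      then show ?case
        using Poly_Mapping.keys_add[of x y] unfolding monomial_ideal_def by (simp; blast)
    qed
  qed
  show "?R \<subseteq> ?L"
  proof
    fix p :: "('e, 'k) mpoly" assume p: "p \<in> ?R"
    have id: "ideal ?L (poly_ring K E)"
      by (intro ideal_prod_is_ideal ideal_monomial_ideal assms)
    show "p \<in> ?L"
    proof (rule mem_ideal_if_monomials[OF id])
      fix m assume "m \<in> Poly_Mapping.keys p"
      with p obtain u v where m: "Poly_Mapping.keys m \<subseteq> E" "m = u + v" "u \<in> U" "v \<in> V"
        by (auto simp: monomial_ideal_def)
      have "Poly_Mapping.single u 1 \<otimes>\<^bsub>poly_ring K E\<^esub> Poly_Mapping.single v 1 \<in> ?L"
        by (rule ideal_prod.prod) (use m in \<open>auto simp: monomial_ideal_def keys_add_nat\<close>)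
      then show "Poly_Mapping.single m 1 \<in> ?L" using m by (simp add: mult_single)
    qed
  qed
qed

text \<open>\<open>N A\<close> is the multiplicity of the generator belonging to \<open>A\<close>.
  For finite \<open>\<A>\<close> with finite members and \<open>y\<close> an exponent vector, this
  says that a product of \<open>q\<close> or more generators divides the monomial of
  \<open>y\<close>.\<close>

definition packs :: "'e set set \<Rightarrow> nat \<Rightarrow> ('e \<Rightarrow> nat) \<Rightarrow> bool" where
  "packs \<A> q y \<longleftrightarrow> (\<exists>N. q \<le> (\<Sum>A\<in>\<A>. N A) \<and> (\<forall>e. (\<Sum>A\<in>{A\<in>\<A>. e \<in> A}. N A) \<le> y e))"

lemma packs_0 [simp]: "packs \<A> 0 y"
  unfolding packs_def by (rule exI[of _ "\<lambda>_. 0"]) simp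

lemma packs_mono: "packs \<A> q y \<Longrightarrow> (\<And>e. y e \<le> z e) \<Longrightarrow> packs \<A> q z"
  unfolding packs_def by (meson order_trans)

text \<open>Any member of positive multiplicity can be split off. The summand \<open>v\<close> may
  be any multiple of a generator, which matches the shape of a product with the ideal.\<close>

lemma packs_Suc:
  fixes m :: "'e \<Rightarrow>\<^sub>0 nat"
  assumes fin: "finite \<A>" and finA: "\<And>A. A \<in> \<A> \<Longrightarrow> finite A"
  shows "packs \<A> (Suc q) (Poly_Mapping.lookup m) \<longleftrightarrow>
    (\<exists>u v A. packs \<A> q (Poly_Mapping.lookup u) \<and> A \<in> \<A> \<and> A \<subseteq> Poly_Mapping.keys v \<and> m = u + v)"
proof
  assume "packs \<A> (Suc q) (Poly_Mapping.lookup m)"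
  then obtain N where N: "Suc q \<le> (\<Sum>A\<in>\<A>. N A)"
    "\<And>e. (\<Sum>A\<in>{A\<in>\<A>. e \<in> A}. N A) \<le> Poly_Mapping.lookup m e"
    unfolding packs_def by blast
  obtain A where A: "A \<in> \<A>" "N A > 0"
    using N(1) by (metis Zero_neq_Suc gr0I le_zero_eq sum.neutral)
  define N' where "N' = N(A := N A - 1)"
  have split: "(\<Sum>B\<in>S. N B) = (\<Sum>B\<in>S. N' B) + (if A \<in> S then 1 else 0)" if "finite S" for S
  proof -
    have "N B = N' B + (if B = A then 1 else 0)" for B using A by (simp add: N'_def)
    then show ?thesis using that by (simp add: sum.distrib)
  qed
  have le: "(\<Sum>B\<in>{B\<in>\<A>. e \<in> B}. N' B) + (if e \<in> A then 1 else 0) \<le> Poly_Mapping.lookup m e" for e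
    using N(2)[of e] split[of "{B\<in>\<A>. e \<in> B}"] fin A by simp
  have eq: "(m - indicator_monom A) + indicator_monom A = m"
  proof (rule add_diff_monom)
    fix e show "Poly_Mapping.lookup (indicator_monom A) e \<le> Poly_Mapping.lookup m e"
      using le[of e] finA[OF A(1)] by (simp add: lookup_indicator_monom split: if_splits)
  qed
  have "packs \<A> q (Poly_Mapping.lookup (m - indicator_monom A))"
    unfolding packs_def
  proof (rule exI[of _ N'], intro conjI allI)
    show "q \<le> sum N' \<A>" using N(1) split[OF fin] A by simp
    fix e show "(\<Sum>B\<in>{B\<in>\<A>. e \<in> B}. N' B) \<le> Poly_Mapping.lookup (m - indicator_monom A) e"
      using le[of e] finA[OF A(1)] by (simp add: lookup_indicator_monom lookup_minus split: if_splits)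
  qed
  then show "\<exists>u v A. packs \<A> q (Poly_Mapping.lookup u) \<and> A \<in> \<A> \<and> A \<subseteq> Poly_Mapping.keys v \<and> m = u + v"
    using eq A(1) keys_indicator_monom[OF finA[OF A(1)]] by (metis order_refl)
next
  assume "\<exists>u v A. packs \<A> q (Poly_Mapping.lookup u) \<and> A \<in> \<A> \<and> A \<subseteq> Poly_Mapping.keys v \<and> m = u + v"
  then obtain u v A N where A: "A \<in> \<A>" "A \<subseteq> Poly_Mapping.keys v" and m: "m = u + v"
    and N: "q \<le> (\<Sum>A\<in>\<A>. N A)" "\<And>e. (\<Sum>A\<in>{A\<in>\<A>. e \<in> A}. N A) \<le> Poly_Mapping.lookup u e"
    unfolding packs_def by blast
  define N' where "N' = N(A := N A + 1)"
  have split: "(\<Sum>B\<in>S. N' B) = (\<Sum>B\<in>S. N B) + (if A \<in> S then 1 else 0)" if "finite S" for S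
  proof -
    have "N' B = N B + (if B = A then 1 else 0)" for B by (simp add: N'_def)
    then show ?thesis using that by (simp add: sum.distrib)
  qed
  have v: "(if e \<in> A then 1 else 0) \<le> Poly_Mapping.lookup v e" for e
    using A by (auto simp: in_keys_iff Suc_le_eq)
  show "packs \<A> (Suc q) (Poly_Mapping.lookup m)"
    unfolding packs_def
  proof (rule exI[of _ N'], intro conjI allI)
    show "Suc q \<le> sum N' \<A>" using N(1) split[OF fin] A by simp
    fix e show "(\<Sum>B\<in>{B\<in>\<A>. e \<in> B}. N' B) \<le> Poly_Mapping.lookup m e"
      using add_mono[OF N(2)[of e] v[of e]] split[of "{B\<in>\<A>. e \<in> B}"] fin A(1)
      by (simp add: m lookup_add)
  qed
qed

lemma ideal_power_sqfree:
  fixes K :: "'k::field itself" and \<A> :: "'e set set"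
  assumes fin: "finite E" and sub: "\<A> \<subseteq> Pow E"
  shows "ideal_power (poly_ring K E) (monomial_ideal E {m. \<exists>A\<in>\<A>. A \<subseteq> Poly_Mapping.keys m}) q =
         monomial_ideal E {m. packs \<A> q (Poly_Mapping.lookup m)}"
proof (induction q)
  case 0
  \<comment> \<open>The zeroth power is the unit of the monoid of ideals, hence the whole ring, and
    \<open>packs\<close> is always true for \<open>0\<close>.\<close>
  show ?case by (auto simp: ideals_set_def monomial_ideal_def poly_ring_def)
next
  case (Suc q)
  have finA: "finite A" if "A \<in> \<A>" for A using that fin sub finite_subset by blast
  have "finite \<A>" using fin sub by (simp add: finite_subset)
  show ?case
    unfolding nat_pow_Suc Suc
    apply (simp add: ideals_set_def)
    apply (subst ideal_prod_monomial_ideal)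
    subgoal by (auto elim: packs_mono simp: lookup_add)
    subgoal by (auto simp: keys_add_nat)
    apply (rule arg_cong[of _ _ "monomial_ideal E"])
    using packs_Suc[OF \<open>finite \<A>\<close> finA] by blast
qed

section \<open>Monomial primes and their powers\<close>

definition monomial_prime :: "'e set \<Rightarrow> 'e set \<Rightarrow> ('e, 'k::field) mpoly set" where
  "monomial_prime E C = monomial_ideal E {m. Poly_Mapping.keys m \<inter> C \<noteq> {}}"

text \<open>The prime is the squarefree ideal of the clutter of singletons from \<open>C\<close>.
  Singletons do not compete for elements, so the largest packing into \<open>y\<close> has the
  weight of \<open>y\<close> on \<open>C\<close> as its size.\<close>

lemma ideal_power_monomial_prime:
  fixes K :: "'k::field itself" and C :: "'e set"
  assumes fin: "finite E" and C: "C \<subseteq> E"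
  shows "ideal_power (poly_ring K E) (monomial_prime E C) s =
         monomial_ideal E {m. s \<le> (\<Sum>e\<in>C. Poly_Mapping.lookup m e)}"
proof -
  let ?A = "(\<lambda>e. {e}) ` C"
  have finC: "finite C" using fin C finite_subset by blast
  have "monomial_prime E C = (monomial_ideal E {m. \<exists>A\<in>?A. A \<subseteq> Poly_Mapping.keys m} :: ('e, 'k) mpoly set)"
    unfolding monomial_prime_def by (rule arg_cong[of _ _ "monomial_ideal E"]) auto
  moreover have "ideal_power (poly_ring K E) (monomial_ideal E {m. \<exists>A\<in>?A. A \<subseteq> Poly_Mapping.keys m}) s =
      monomial_ideal E {m. packs ?A s (Poly_Mapping.lookup m)}"
    by (rule ideal_power_sqfree) (use fin C in auto)
  moreover have "packs ?A s y \<longleftrightarrow> s \<le> (\<Sum>e\<in>C. y e)" for y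
  proof
    assume "packs ?A s y"
    then obtain N where N: "s \<le> (\<Sum>A\<in>?A. N A)" "\<And>e. (\<Sum>A\<in>{A\<in>?A. e \<in> A}. N A) \<le> y e"
      unfolding packs_def by blast
    have "N {e} \<le> y e" if "e \<in> C" for e
    proof -
      have "{A\<in>?A. e \<in> A} = {{e}}" using that by auto
      then show ?thesis using N(2)[of e] by simp
    qed
    then have "(\<Sum>e\<in>C. N {e}) \<le> (\<Sum>e\<in>C. y e)" by (rule sum_mono)
    then show "s \<le> (\<Sum>e\<in>C. y e)" using N(1) by (simp add: sum.reindex)
  next
    assume s: "s \<le> (\<Sum>e\<in>C. y e)"
    \<comment> \<open>Each singleton is taken as often as \<open>y\<close> allows;
      \<open>the_elem\<close> recovers its element.\<close>
    define N where "N A = y (the_elem A)" for A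
    have "(\<Sum>A\<in>{A\<in>?A. e \<in> A}. N A) \<le> y e" for e
    proof (cases "e \<in> C")
      case True
      then have "{A\<in>?A. e \<in> A} = {{e}}" by auto
      then show ?thesis by (simp add: N_def)
    next
      case False
      then have *: "{A\<in>?A. e \<in> A} = {}" by auto
      show ?thesis unfolding * by simp
    qed
    moreover have "s \<le> (\<Sum>A\<in>?A. N A)" using s by (simp add: sum.reindex N_def)
    ultimately show "packs ?A s y" unfolding packs_def by blast
  qed
  ultimately show ?thesis by simp
qed

text \<open>After the terms at \<open>u\<close> and \<open>v\<close> are split off, nothing in the
  remaining products can reach the exponent \<open>u + v\<close>. This will be applied to leading
  monomials.\<close>

lemma lookup_mult_unique_product:
  fixes f g :: "'a::cancel_comm_monoid_add \<Rightarrow>\<^sub>0 'k::ring"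
  assumes uniq: "\<And>a b. a \<in> Poly_Mapping.keys f \<Longrightarrow> b \<in> Poly_Mapping.keys g \<Longrightarrow> a + b = u + v
      \<Longrightarrow> a = u \<and> b = v"
  shows "Poly_Mapping.lookup (f * g) (u + v) = Poly_Mapping.lookup f u * Poly_Mapping.lookup g v"
proof -
  define f' where "f' = f - Poly_Mapping.single u (Poly_Mapping.lookup f u)"
  define g' where "g' = g - Poly_Mapping.single v (Poly_Mapping.lookup g v)"
  have f: "f = Poly_Mapping.single u (Poly_Mapping.lookup f u) + f'"
    and g: "g = Poly_Mapping.single v (Poly_Mapping.lookup g v) + g'"
    by (simp_all add: f'_def g'_def)
  have kf: "Poly_Mapping.keys f' \<subseteq> Poly_Mapping.keys f - {u}"
    and kg: "Poly_Mapping.keys g' \<subseteq> Poly_Mapping.keys g - {v}"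
    by (auto simp: in_keys_iff f'_def g'_def lookup_minus lookup_single when_def split: if_splits)
  have "u + v \<notin> Poly_Mapping.keys (f' * g)"
    using Poly_Mapping.keys_mult[of f' g] kf uniq by fastforce
  moreover have "u + v \<notin> Poly_Mapping.keys (Poly_Mapping.single u (Poly_Mapping.lookup f u) * g')"
  proof
    assume "u + v \<in> Poly_Mapping.keys (Poly_Mapping.single u (Poly_Mapping.lookup f u) * g')"
    then obtain b where "b \<in> Poly_Mapping.keys g'" "u + v = u + b"
      using Poly_Mapping.keys_mult[of "Poly_Mapping.single u (Poly_Mapping.lookup f u)" g']
      by (fastforce split: if_splits)
    then show False using kg by auto
  qed
  moreover have "f * g = Poly_Mapping.single (u + v) (Poly_Mapping.lookup f u * Poly_Mapping.lookup g v)
      + Poly_Mapping.single u (Poly_Mapping.lookup f u) * g' + f' * g"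
    (is "_ = ?s + ?t + ?r")
  proof -
    have "f * g = Poly_Mapping.single u (Poly_Mapping.lookup f u) * g + f' * g"
      by (subst f) (simp only: distrib_right)
    moreover have "Poly_Mapping.single u (Poly_Mapping.lookup f u) * g = ?s + ?t"
      by (subst g) (simp only: distrib_left mult_single)
    ultimately show ?thesis by simp
  qed
  ultimately show ?thesis
    by (simp add: lookup_add in_keys_iff)
qed

section \<open>Minimal primes and symbolic powers\<close>

text \<open>The minimal transversals of \<open>\<A>\<close>; for the bases of a matroid these are
  the cocircuits.\<close>

definition blocker :: "'e set \<Rightarrow> 'e set set \<Rightarrow> 'e set set" where
  "blocker E \<A> = {C. C \<subseteq> E \<and> (\<forall>A\<in>\<A>. A \<inter> C \<noteq> {}) \<and> (\<forall>D. D \<subset> C \<longrightarrow> (\<exists>A\<in>\<A>. A \<inter> D = {}))}"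

lemma blocker_meets: "C \<in> blocker E \<A> \<Longrightarrow> A \<in> \<A> \<Longrightarrow> A \<inter> C \<noteq> {}"
  by (simp add: blocker_def)

lemma ex_blocker_subset:
  assumes fin: "finite E" and T: "T \<subseteq> E" and meet: "\<And>A. A \<in> \<A> \<Longrightarrow> A \<inter> T \<noteq> {}"
  shows "\<exists>C\<in>blocker E \<A>. C \<subseteq> T"
proof -
  let ?X = "{C. C \<subseteq> T \<and> (\<forall>A\<in>\<A>. A \<inter> C \<noteq> {})}"
  have "finite T" using fin T finite_subset by blast
  then have finX: "finite ?X" by simp
  have "?X \<noteq> {}" using meet by blast
  then obtain C where C: "C \<in> ?X" "\<forall>D\<in>?X. D \<subseteq> C \<longrightarrow> C = D"
    using finite_has_minimal[OF finX] by (metis (no_types, lifting))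
  have "C \<in> blocker E \<A>"
    unfolding blocker_def
  proof (intro CollectI conjI allI impI)
    fix D assume "D \<subset> C"
    then show "\<exists>A\<in>\<A>. A \<inter> D = {}" using C(1) bspec[OF C(2), of D] by fastforce
  qed (use C T in auto)
  then show ?thesis using C by blast
qed

text \<open>If \<open>X\<close> contained no member of \<open>\<A>\<close>, then
  \<open>E - X\<close> would meet every member, and a minimal transversal inside it would miss
  \<open>X\<close>. Conversely, for \<open>D\<close> properly inside a member \<open>A\<close>, the
  antichain property makes \<open>E - D\<close> meet every member, so some minimal transversal
  misses \<open>D\<close>.\<close>

lemma blocker_blocker:
  assumes fin: "finite E" and sub: "\<A> \<subseteq> Pow E" and anti: "\<And>A B. A \<in> \<A> \<Longrightarrow> B \<in> \<A> \<Longrightarrow> A \<subseteq> B \<Longrightarrow> A = B"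
  shows "blocker E (blocker E \<A>) = \<A>"
proof (intro equalityI subsetI)
  fix X assume X: "X \<in> blocker E (blocker E \<A>)"
  then have XE: "X \<subseteq> E" and meet: "\<And>C. C \<in> blocker E \<A> \<Longrightarrow> C \<inter> X \<noteq> {}"
    and min: "\<And>D. D \<subset> X \<Longrightarrow> \<exists>C\<in>blocker E \<A>. C \<inter> D = {}" by (auto simp: blocker_def)
  have "\<exists>A\<in>\<A>. A \<subseteq> X"
  proof (rule ccontr)
    assume none: "\<not> ?thesis"
    have "A \<inter> (E - X) \<noteq> {}" if "A \<in> \<A>" for A
    proof -
      have "A \<subseteq> E" "\<not> A \<subseteq> X" using none sub that by blast+
      then show ?thesis by blast
    qed
    then obtain C where "C \<in> blocker E \<A>" "C \<subseteq> E - X"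
      using ex_blocker_subset[OF fin, of "E - X" \<A>] by auto
    then show False using meet by blast
  qed
  then obtain A where A: "A \<in> \<A>" "A \<subseteq> X" by blast
  have "C \<inter> A \<noteq> {}" if "C \<in> blocker E \<A>" for C using that A(1) unfolding blocker_def by (simp add: Int_commute)
  then have "\<not> A \<subset> X" using min[of A] by auto
  then show "X \<in> \<A>" using A by (metis psubsetI)
next
  fix A assume A: "A \<in> \<A>"
  then have AE: "A \<subseteq> E" using sub by blast
  show "A \<in> blocker E (blocker E \<A>)"
    unfolding blocker_def[of E "blocker E \<A>"]
  proof (intro CollectI conjI ballI allI impI)
    show "C \<inter> A \<noteq> {}" if "C \<in> blocker E \<A>" for C
      using that A unfolding blocker_def by (simp add: Int_commute)
    fix D assume D: "D \<subset> A"
    have "B \<inter> (E - D) \<noteq> {}" if B: "B \<in> \<A>" for B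
    proof
      assume "B \<inter> (E - D) = {}"
      then have "B \<subset> A" using B sub D by blast
      then show False using anti[OF B A] by blast
    qed
    then obtain C where "C \<in> blocker E \<A>" "C \<subseteq> E - D"
      using ex_blocker_subset[OF fin, of "E - D" \<A>] by auto
    then show "\<exists>C\<in>blocker E \<A>. C \<inter> D = {}" by blast
  qed (rule AE)
qed

text \<open>Modulo the prime only monomials avoiding \<open>C\<close> matter. Two polynomials
  outside the prime have leading monomials among these, and the product of the leading terms
  survives in the product of the polynomials.\<close>

lemma primeideal_monomial_prime:
  fixes K :: "'k::field itself" and C :: "'e set"
  assumes fin: "finite E"
  shows "primeideal (monomial_prime E C) (poly_ring K E)"
proof -
  let ?P = "monomial_prime E C :: ('e, 'k) mpoly set"
  obtain h :: "'e \<Rightarrow> nat" where h: "inj_on h E"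
    using finite_imp_inj_to_nat_seg[OF fin] by blast
  text \<open>Transporting exponent vectors along \<open>h\<close> provides a monomial order, hence leading monomials.\<close>
  define \<phi> where "\<phi> m = (\<Sum>e\<in>E. Poly_Mapping.single (h e) (Poly_Mapping.lookup m e))" for m :: "'e \<Rightarrow>\<^sub>0 nat"
  have \<phi>_add: "\<phi> (u + v) = \<phi> u + \<phi> v" for u v
    by (simp add: \<phi>_def lookup_add single_add sum.distrib)
  have \<phi>_inj: "u = v" if "\<phi> u = \<phi> v" "Poly_Mapping.keys u \<subseteq> E" "Poly_Mapping.keys v \<subseteq> E" for u v
  proof (rule poly_mapping_eqI)
    fix e
    have *: "Poly_Mapping.lookup (\<phi> m) (h e) = Poly_Mapping.lookup m e" if "e \<in> E" for m
    proof -
      have "Poly_Mapping.lookup (\<phi> m) (h e) = (\<Sum>e'\<in>E. if e' = e then Poly_Mapping.lookup m e' else 0)"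
        unfolding \<phi>_def lookup_sum
        by (rule sum.cong) (use h that in \<open>auto simp: lookup_single when_def inj_on_def\<close>)
      then show ?thesis using fin that by simp
    qed
    show "Poly_Mapping.lookup u e = Poly_Mapping.lookup v e"
    proof (cases "e \<in> E")
      case True
      then show ?thesis using *[of u] *[of v] that(1) by simp
    next
      case False
      then have "e \<notin> Poly_Mapping.keys u" "e \<notin> Poly_Mapping.keys v" using that by auto
      then show ?thesis by (simp add: in_keys_iff)
    qed
  qed
  \<comment> \<open>The maximum is taken only over monomials that avoid \<open>C\<close>; there is
    one because \<open>a\<close> lies outside the prime.\<close>
  have leading: "\<exists>u\<in>Poly_Mapping.keys a. Poly_Mapping.keys u \<inter> C = {} \<and>
      (\<forall>x\<in>Poly_Mapping.keys a. Poly_Mapping.keys x \<inter> C = {} \<longrightarrow> \<phi> x \<le> \<phi> u)"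
    if "a \<in> carrier (poly_ring K E)" "a \<notin> ?P" for a
  proof -
    define X where "X = {x\<in>Poly_Mapping.keys a. Poly_Mapping.keys x \<inter> C = {}}"
    have "finite X" "X \<noteq> {}"
      using that by (auto simp: X_def monomial_prime_def monomial_ideal_def)
    then have "Max (\<phi> ` X) \<in> \<phi> ` X" "\<forall>x\<in>X. \<phi> x \<le> Max (\<phi> ` X)" by auto
    then obtain u where "u \<in> X" "\<forall>x\<in>X. \<phi> x \<le> \<phi> u" by auto
    then show ?thesis unfolding X_def by blast
  qed
  show ?thesis
  proof (intro primeideal.intro primeideal_axioms.intro)
    show "cring (poly_ring K E)" by (rule cring_poly_ring)
    show "ideal ?P (poly_ring K E)"
      unfolding monomial_prime_def by (rule ideal_monomial_ideal) (auto simp: keys_add_nat)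
    have "1 \<in> carrier (poly_ring K E)" "1 \<notin> ?P"
      by (auto simp: monomial_prime_def monomial_ideal_def)
    then show "carrier (poly_ring K E) \<noteq> ?P" by blast
  next
    fix a b
    assume a: "a \<in> carrier (poly_ring K E)" and b: "b \<in> carrier (poly_ring K E)"
      and ab: "a \<otimes>\<^bsub>poly_ring K E\<^esub> b \<in> ?P"
    show "a \<in> ?P \<or> b \<in> ?P"
    proof (rule ccontr)
      assume "\<not> ?thesis"
      then have na: "a \<notin> ?P" and nb: "b \<notin> ?P" by auto
      obtain u where u: "u \<in> Poly_Mapping.keys a" "Poly_Mapping.keys u \<inter> C = {}"
        and umax: "\<And>x. x \<in> Poly_Mapping.keys a \<Longrightarrow> Poly_Mapping.keys x \<inter> C = {} \<Longrightarrow> \<phi> x \<le> \<phi> u"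
        using leading[OF a na] by blast
      obtain v where v: "v \<in> Poly_Mapping.keys b" "Poly_Mapping.keys v \<inter> C = {}"
        and vmax: "\<And>x. x \<in> Poly_Mapping.keys b \<Longrightarrow> Poly_Mapping.keys x \<inter> C = {} \<Longrightarrow> \<phi> x \<le> \<phi> v"
        using leading[OF b nb] by blast
      have "Poly_Mapping.lookup (a * b) (u + v) = Poly_Mapping.lookup a u * Poly_Mapping.lookup b v"
      proof (rule lookup_mult_unique_product)
        fix x y
        assume x: "x \<in> Poly_Mapping.keys a" and y: "y \<in> Poly_Mapping.keys b" and xy: "x + y = u + v"
        \<comment> \<open>Supports cannot cancel in a sum of exponent vectors, so \<open>x\<close>
          and \<open>y\<close> avoid \<open>C\<close> too and the maximality of \<open>u\<close> and
          \<open>v\<close> applies to them.\<close>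
        have "(Poly_Mapping.keys x \<union> Poly_Mapping.keys y) \<inter> C = {}"
          using u v xy by (metis keys_add_nat Int_Un_distrib2 Un_empty)
        then have le: "\<phi> x \<le> \<phi> u" "\<phi> y \<le> \<phi> v" using umax[OF x] vmax[OF y] by auto
        moreover have sum: "\<phi> x + \<phi> y = \<phi> u + \<phi> v" using xy by (metis \<phi>_add)
        ultimately have "\<phi> x = \<phi> u"
          by (metis add_less_le_mono less_irrefl order_le_less)
        then have "\<phi> x = \<phi> u" "\<phi> y = \<phi> v" using sum by auto
        then show "x = u \<and> y = v" using \<phi>_inj a b x y u v by simp
      qed
      then have "u + v \<in> Poly_Mapping.keys (a * b)"
        using u v by (simp add: in_keys_iff)
      then have "Poly_Mapping.keys (u + v) \<inter> C \<noteq> {}"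
        using ab by (simp add: monomial_prime_def monomial_ideal_def)
      then show False using u v by (auto simp: keys_add_nat)
    qed
  qed
qed

text \<open>A prime containing a squarefree monomial contains one of its variables. Hence the
  variables in \<open>Q\<close> form a transversal of \<open>\<A>\<close>, and a minimal one inside
  it gives \<open>C\<close>.\<close>

lemma prime_contains_monomial_prime:
  fixes K :: "'k::field itself" and \<A> :: "'e set set"
  assumes fin: "finite E" and sub: "\<A> \<subseteq> Pow E"
    and Q: "primeideal Q (poly_ring K E)"
    and IQ: "monomial_ideal E {m. \<exists>A\<in>\<A>. A \<subseteq> Poly_Mapping.keys m} \<subseteq> Q"
  shows "\<exists>C\<in>blocker E \<A>. monomial_prime E C \<subseteq> Q"
proof -
  interpret primeideal Q "poly_ring K E" by (rule Q)
  have one: "1 \<notin> Q" using one_imp_carrier I_notcarr by auto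
  define T where "T = {e\<in>E. var e \<in> Q}"
  have "A \<inter> T \<noteq> {}" if A: "A \<in> \<A>" for A
  proof -
    have finA: "finite A" and AE: "A \<subseteq> E" using A sub fin finite_subset by blast+
    have "sqfree_monom A \<in> monomial_ideal E {m. \<exists>A\<in>\<A>. A \<subseteq> Poly_Mapping.keys m}"
      using A AE by (auto simp: sqfree_monom_eq_single[OF finA] monomial_ideal_def
          keys_indicator_monom[OF finA])
    then have "sqfree_monom A \<in> Q" using IQ by blast
    with finA AE show ?thesis
    proof (induction A rule: finite_induct)
      case empty
      then show ?case using one by (simp add: sqfree_monom_def)
    next
      case (insert e A)
      have "var e \<in> carrier (poly_ring K E)" using insert.prems by (simp add: var_def)
      moreover have "sqfree_monom A \<in> carrier (poly_ring K E)"
        using insert by (simp add: sqfree_monom_eq_single keys_indicator_monom)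
      moreover have "var e \<otimes>\<^bsub>poly_ring K E\<^esub> sqfree_monom A \<in> Q"
        using insert by (simp add: sqfree_monom_def)
      ultimately have "var e \<in> Q \<or> sqfree_monom A \<in> Q" by (rule I_prime)
      then show ?case using insert by (auto simp: T_def)
    qed
  qed
  then obtain C where C: "C \<in> blocker E \<A>" "C \<subseteq> T"
    using ex_blocker_subset[OF fin, of T \<A>] by (auto simp: T_def)
  have "monomial_prime E C \<subseteq> Q"
  proof
    fix p :: "('e, 'k) mpoly" assume p: "p \<in> monomial_prime E C"
    show "p \<in> Q"
    proof (rule mem_ideal_if_monomials[OF is_ideal])
      fix m assume "m \<in> Poly_Mapping.keys p"
      with p obtain e where m: "Poly_Mapping.keys m \<subseteq> E" and e: "e \<in> C" "e \<in> Poly_Mapping.keys m"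
        by (auto simp: monomial_prime_def monomial_ideal_def)
      have eq: "(m - Poly_Mapping.single e 1) + Poly_Mapping.single e 1 = m"
        using e by (intro add_diff_monom) (auto simp: lookup_single in_keys_iff when_def)
      have "Poly_Mapping.keys (m - Poly_Mapping.single e 1) \<subseteq> Poly_Mapping.keys m"
        by (auto simp: in_keys_iff lookup_minus)
      then have "Poly_Mapping.single (m - Poly_Mapping.single e 1) 1 \<otimes>\<^bsub>poly_ring K E\<^esub> var e \<in> Q"
        using m e C by (intro I_l_closed) (auto simp: T_def)
      then show "Poly_Mapping.single m 1 \<in> Q" using eq by (simp add: var_def mult_single)
    qed
  qed
  then show ?thesis using C by blast
qed

lemma monomial_prime_subset_iff:
  assumes "C \<subseteq> E"
  shows "(monomial_prime E C :: ('e, 'k::field) mpoly set) \<subseteq> monomial_prime E D \<longleftrightarrow> C \<subseteq> D"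
proof
  assume sub: "(monomial_prime E C :: ('e, 'k) mpoly set) \<subseteq> monomial_prime E D"
  show "C \<subseteq> D"
  proof
    fix e assume "e \<in> C"
    then have "(var e :: ('e, 'k) mpoly) \<in> monomial_prime E C"
      using assms by (auto simp: var_def monomial_prime_def monomial_ideal_def)
    then have "(var e :: ('e, 'k) mpoly) \<in> monomial_prime E D" using sub by blast
    then show "e \<in> D" by (auto simp: var_def monomial_prime_def monomial_ideal_def)
  qed
next
  assume "C \<subseteq> D"
  then have "Poly_Mapping.keys m \<inter> C \<noteq> {} \<Longrightarrow> Poly_Mapping.keys m \<inter> D \<noteq> {}" for m :: "'e \<Rightarrow>\<^sub>0 nat"
    by blast
  then show "(monomial_prime E C :: ('e, 'k) mpoly set) \<subseteq> monomial_prime E D"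
    by (simp add: monomial_prime_def monomial_ideal_def subset_iff)
qed

text \<open>Every prime above the ideal contains the monomial prime of some minimal transversal, and
  these monomial primes are pairwise incomparable because the blocker is an antichain.\<close>

lemma minimal_primes_sqfree:
  fixes K :: "'k::field itself" and \<A> :: "'e set set"
  assumes fin: "finite E" and sub: "\<A> \<subseteq> Pow E"
  shows "minimal_primes (poly_ring K E) (monomial_ideal E {m. \<exists>A\<in>\<A>. A \<subseteq> Poly_Mapping.keys m})
       = monomial_prime E ` blocker E \<A>" (is "minimal_primes ?R ?I = _")
proof -
  have cont: "?I \<subseteq> monomial_prime E C" if "C \<in> blocker E \<A>" for C
    using that by (fastforce simp: blocker_def monomial_prime_def monomial_ideal_def)
  have CE: "C \<subseteq> E" if "C \<in> blocker E \<A>" for C using that by (simp add: blocker_def)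
  have anti: "C = D" if "C \<in> blocker E \<A>" "D \<in> blocker E \<A>" "C \<subseteq> D" for C D
    using that unfolding blocker_def by blast
  have below: "\<exists>C\<in>blocker E \<A>. monomial_prime E C \<subseteq> Q"
    if "primeideal Q ?R" "?I \<subseteq> Q" for Q
    using prime_contains_monomial_prime[OF fin sub] that by blast
  show ?thesis
  proof (intro equalityI subsetI)
    fix P assume P: "P \<in> minimal_primes ?R ?I"
    then obtain C where C: "C \<in> blocker E \<A>" "monomial_prime E C \<subseteq> P"
      using below[of P] unfolding minimal_primes_def by blast
    then have "monomial_prime E C = P"
      using P cont[OF C(1)] primeideal_monomial_prime[OF fin, where C = C and K = K]
      by (simp add: minimal_primes_def)
    then show "P \<in> monomial_prime E ` blocker E \<A>" using C by blast
  next
    fix P assume "P \<in> (monomial_prime E ` blocker E \<A> :: ('e, 'k) mpoly set set)"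
    then obtain C where C: "C \<in> blocker E \<A>" and P: "P = monomial_prime E C" by blast
    have "Q = P" if Q: "primeideal Q ?R" "?I \<subseteq> Q" "Q \<subseteq> P" for Q
    proof -
      obtain D where D: "D \<in> blocker E \<A>" "monomial_prime E D \<subseteq> Q" using below[OF Q(1,2)] by blast
      then have "(monomial_prime E D :: ('e, 'k) mpoly set) \<subseteq> monomial_prime E C" using Q P by blast
      then have "D = C" using monomial_prime_subset_iff[OF CE[OF D(1)]] anti[OF D(1) C] by blast
      then show ?thesis using D Q P by blast
    qed
    then show "P \<in> minimal_primes ?R ?I"
      unfolding minimal_primes_def P
      using cont[OF C] primeideal_monomial_prime[OF fin] P by simp
  qed
qed

lemma symbolic_power_sqfree:
  fixes K :: "'k::field itself" and \<A> :: "'e set set"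
  assumes fin: "finite E" and sub: "\<A> \<subseteq> Pow E"
  shows "symbolic_power (poly_ring K E) (monomial_ideal E {m. \<exists>A\<in>\<A>. A \<subseteq> Poly_Mapping.keys m}) s
       = monomial_ideal E {m. \<forall>C\<in>blocker E \<A>. s \<le> (\<Sum>e\<in>C. Poly_Mapping.lookup m e)}"
proof -
  have "ideal_power (poly_ring K E) (monomial_prime E C) s =
      monomial_ideal E {m. s \<le> (\<Sum>e\<in>C. Poly_Mapping.lookup m e)}" if "C \<in> blocker E \<A>" for C
    by (rule ideal_power_monomial_prime[OF fin]) (use that in \<open>auto simp: blocker_def\<close>)
  then show ?thesis
    unfolding symbolic_power_def minimal_primes_sqfree[OF fin sub]
    by (simp add: set_eq_iff monomial_ideal_def) blast
qed

section \<open>Initial degrees of monomial ideals\<close>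

lemma monom_deg_eq_sum:
  assumes "finite E" "Poly_Mapping.keys m \<subseteq> E"
  shows "monom_deg m = (\<Sum>e\<in>E. Poly_Mapping.lookup m e)"
  unfolding monom_deg_def
  by (rule sum.mono_neutral_left) (use assms in \<open>auto simp: in_keys_iff\<close>)

text \<open>Each monomial of a nonzero homogeneous element is admissible itself and has the same
  degree.\<close>

lemma initial_degree_monomial_ideal:
  "initial_degree (monomial_ideal E U :: ('e, 'k::field) mpoly set) =
     (LEAST d. \<exists>m\<in>U. Poly_Mapping.keys m \<subseteq> E \<and> monom_deg m = d)"
proof -
  have "(\<exists>f\<in>monomial_ideal E U :: ('e, 'k) mpoly set. f \<noteq> 0 \<and> homogeneous_of_degree d f) \<longleftrightarrow>
        (\<exists>m\<in>U. Poly_Mapping.keys m \<subseteq> E \<and> monom_deg m = d)" for d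
  proof
    assume "\<exists>f\<in>monomial_ideal E U :: ('e, 'k) mpoly set. f \<noteq> 0 \<and> homogeneous_of_degree d f"
    then obtain f :: "('e, 'k) mpoly" where f: "f \<in> monomial_ideal E U" "f \<noteq> 0" "homogeneous_of_degree d f"
      by auto
    have "f = 0" if "Poly_Mapping.keys f = {}"
      using that by (intro poly_mapping_eqI) (simp add: set_eq_iff in_keys_iff)
    then obtain m where "m \<in> Poly_Mapping.keys f" using f(2) by blast
    then show "\<exists>m\<in>U. Poly_Mapping.keys m \<subseteq> E \<and> monom_deg m = d"
      using f by (auto simp: monomial_ideal_def homogeneous_of_degree_def)
  next
    assume "\<exists>m\<in>U. Poly_Mapping.keys m \<subseteq> E \<and> monom_deg m = d"
    then obtain m where m: "m \<in> U" "Poly_Mapping.keys m \<subseteq> E" "monom_deg m = d" by blast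
    show "\<exists>f\<in>monomial_ideal E U :: ('e, 'k) mpoly set. f \<noteq> 0 \<and> homogeneous_of_degree d f"
    proof (rule bexI[of _ "Poly_Mapping.single m 1"])
      show "Poly_Mapping.single m (1::'k) \<noteq> 0 \<and> homogeneous_of_degree d (Poly_Mapping.single m (1::'k))"
        using m by (metis (no_types, lifting) homogeneous_of_degree_def keys_single lookup_single_eq
            lookup_zero one_neq_zero singletonD)
    qed (use m in \<open>auto simp: monomial_ideal_def\<close>)
  qed
  then show ?thesis by (simp add: initial_degree_def)
qed

lemma initial_degree_le:
  assumes "finite E" "m \<in> U" "Poly_Mapping.keys m \<subseteq> E"
  shows "initial_degree (monomial_ideal E U :: ('e, 'k::field) mpoly set) \<le> (\<Sum>e\<in>E. Poly_Mapping.lookup m e)"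
  unfolding initial_degree_monomial_ideal using assms
  by (intro Least_le) (auto simp: monom_deg_eq_sum)

text \<open>The monomial \<open>m\<close> ensures that the \<open>LEAST\<close> in the initial
  degree ranges over a nonempty set.\<close>

lemma initial_degree_attained:
  assumes "finite E" "m \<in> U" "Poly_Mapping.keys m \<subseteq> E"
  obtains u where "u \<in> U" "Poly_Mapping.keys u \<subseteq> E"
    "initial_degree (monomial_ideal E U :: ('e, 'k::field) mpoly set) = (\<Sum>e\<in>E. Poly_Mapping.lookup u e)"
proof -
  have "\<exists>d. \<exists>m\<in>U. Poly_Mapping.keys m \<subseteq> E \<and> monom_deg m = d" using assms by blast
  then have "\<exists>u\<in>U. Poly_Mapping.keys u \<subseteq> E \<and>
      monom_deg u = (LEAST d. \<exists>m\<in>U. Poly_Mapping.keys m \<subseteq> E \<and> monom_deg m = d)"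
    by (rule LeastI_ex)
  then show ?thesis
    using that monom_deg_eq_sum[OF assms(1)] unfolding initial_degree_monomial_ideal by metis
qed

section \<open>Fractional packings\<close>

text \<open>Combinations with positive coefficients and at least one term. The empty combination is
  excluded, so the zero vector belongs to the cone only if it arises from a genuine
  combination.\<close>

inductive_set cone :: "('e \<Rightarrow> real) set \<Rightarrow> ('e \<Rightarrow> real) set" for V where
  base: "v \<in> V \<Longrightarrow> v \<in> cone V"
| add: "u \<in> cone V \<Longrightarrow> v \<in> cone V \<Longrightarrow> (\<lambda>e. u e + v e) \<in> cone V"
| scale: "0 < c \<Longrightarrow> u \<in> cone V \<Longrightarrow> (\<lambda>e. c * u e) \<in> cone V"

lemma finite_separation:
  fixes L U :: "real set"
  assumes L: "finite L" and U: "finite U" and lt: "\<And>l u. l \<in> L \<Longrightarrow> u \<in> U \<Longrightarrow> l < u"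
  shows "\<exists>x. (\<forall>l\<in>L. l < x) \<and> (\<forall>u\<in>U. x < u)"
proof -
  consider "L = {}" "U = {}" | "L = {}" "U \<noteq> {}" | "L \<noteq> {}" "U = {}" | "L \<noteq> {}" "U \<noteq> {}" by blast
  then show ?thesis
  proof cases
    case 2
    have "Min U - 1 < u" if "u \<in> U" for u using Min_le[OF U that] by linarith
    then show ?thesis using 2 by blast
  next
    case 3
    have "l < Max L + 1" if "l \<in> L" for l using Max_ge[OF L that] by linarith
    then show ?thesis using 3 by blast
  next
    case 4
    then have "Max L < Min U" using lt L U by simp
    then obtain x where "Max L < x" "x < Min U" using dense by blast
    then show ?thesis using 4 L U by (intro exI[of _ x]) simp
  qed simp
qed

text \<open>Fourier--Motzkin elimination of one coordinate at a time.\<close>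

lemma Ville_alternative:
  fixes V :: "('e \<Rightarrow> real) set"
  assumes "finite E" and "finite V"
  shows "(\<exists>u\<in>cone V. \<forall>e\<in>E. u e \<le> 0) \<or> (\<exists>w. (\<forall>e. 0 \<le> w e) \<and> (\<forall>v\<in>V. 0 < (\<Sum>e\<in>E. w e * v e)))"
  using assms
proof (induction E arbitrary: V rule: finite_induct)
  case empty
  show ?case
  proof (cases "V = {}")
    case True
    then show ?thesis by (intro disjI2 exI[of _ "\<lambda>_. 0"]) simp
  next
    case False
    then show ?thesis by (auto intro: cone.base)
  qed
next
  case (insert x E)
  define N where "N = {v\<in>V. v x \<le> 0}"
  define P where "P = {v\<in>V. 0 < v x}"
  \<comment> \<open>The coefficients are chosen so that coordinate \<open>x\<close> cancels. For
    \<open>n x = 0\<close> the result is just a positive multiple of \<open>n\<close>.\<close>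
  define mix where "mix p n e = p x * n e + (- n x) * p e" for p n :: "'e \<Rightarrow> real" and e
  define V' where "V' = N \<union> (\<lambda>(p, n). mix p n) ` (P \<times> N)"
  have finNP: "finite N" "finite P" using insert.prems by (auto simp: N_def P_def)
  then have finV': "finite V'" by (simp add: V'_def)
  show ?case
    using insert.IH[OF finV']
  proof
    assume "\<exists>u\<in>cone V'. \<forall>e\<in>E. u e \<le> 0"
    then obtain u where u: "u \<in> cone V'" "\<forall>e\<in>E. u e \<le> 0" by blast
    have V': "v \<in> cone V \<and> v x \<le> 0" if v: "v \<in> V'" for v
    proof (cases "v \<in> N")
      case True
      then show ?thesis by (auto simp: N_def intro: cone.base)
    next
      case False
      then obtain p n where pn: "p \<in> P" "n \<in> N" "v = mix p n" using v by (auto simp: V'_def)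
      then have p: "0 < p x" "p \<in> cone V" and n: "n x \<le> 0" "n \<in> cone V"
        by (auto simp: P_def N_def intro: cone.base)
      have "mix p n \<in> cone V"
      proof (cases "n x = 0")
        case True
        then have "mix p n = (\<lambda>e. p x * n e)" by (auto simp: mix_def)
        then show ?thesis using cone.scale[OF p(1) n(2)] by simp
      next
        case False
        then have "0 < - n x" using n by simp
        then have "(\<lambda>e. p x * n e + (- n x) * p e) \<in> cone V"
          by (intro cone.add cone.scale p n)
        then show ?thesis unfolding mix_def[abs_def] .
      qed
      then show ?thesis using pn by (simp add: mix_def)
    qed
    from u(1) have "u \<in> cone V \<and> u x \<le> 0"
    proof induction
      case (base v)
      then show ?case by (rule V')
    next
      case (add u v)
      then show ?case by (auto intro: cone.add)
    next
      case (scale c u)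
      then show ?case by (auto intro: cone.scale simp: mult_nonneg_nonpos)
    qed
    then show ?thesis using u(2) by auto
  next
    assume "\<exists>w. (\<forall>e. 0 \<le> w e) \<and> (\<forall>v\<in>V'. 0 < (\<Sum>e\<in>E. w e * v e))"
    then obtain w where w: "\<And>e. 0 \<le> w e" "\<And>v. v \<in> V' \<Longrightarrow> 0 < (\<Sum>e\<in>E. w e * v e)" by blast
    define S where "S v = (\<Sum>e\<in>E. w e * v e)" for v
    have SN: "0 < S n" if "n \<in> N" for n using w(2) that by (simp add: S_def V'_def)
    have Smix: "0 < p x * S n + (- n x) * S p" if "p \<in> P" "n \<in> N" for p n
    proof -
      have "mix p n \<in> V'" using that by (auto simp: V'_def)
      then have "0 < S (mix p n)" unfolding S_def by (rule w(2))
      also have "S (mix p n) = p x * S n + (- n x) * S p"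
        by (simp add: S_def mix_def sum_distrib_left sum.distrib[symmetric] sum_negf[symmetric] algebra_simps
            del: sum_negf)
      finally show ?thesis .
    qed
    \<comment> \<open>\<open>c\<close> will be the weight of coordinate \<open>x\<close>. Vectors in
      \<open>P\<close> bound it from below, vectors of \<open>N\<close> negative at \<open>x\<close>
      from above, and \<open>0\<close> is added to keep the weight positive. The bounds are
      compatible by \<open>Smix\<close> and \<open>SN\<close>.\<close>
    have "\<exists>c. (\<forall>l\<in>insert 0 ((\<lambda>p. - S p / p x) ` P). l < c) \<and>
              (\<forall>u\<in>(\<lambda>n. S n / (- n x)) ` {n\<in>N. n x < 0}. c < u)"
    proof (rule finite_separation)
      fix l u
      assume l: "l \<in> insert 0 ((\<lambda>p. - S p / p x) ` P)"
        and u: "u \<in> (\<lambda>n. S n / (- n x)) ` {n\<in>N. n x < 0}"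
      from u obtain n where n: "n \<in> N" "n x < 0" "u = S n / (- n x)" by blast
      show "l < u"
      proof (cases "l = 0")
        case True
        then show ?thesis using n SN[of n] by (simp add: divide_pos_neg)
      next
        case False
        then obtain p where p: "p \<in> P" "l = - S p / p x" using l by blast
        have px: "0 < p x" using p by (simp add: P_def)
        have nx: "0 < - n x" using n by simp
        have "- S p * (- n x) < S n * p x" using Smix[OF p(1) n(1)] by (simp add: algebra_simps)
        then have "- S p / p x < S n / (- n x)"
          using px nx by (simp add: divide_less_eq less_divide_eq mult.commute)
        then show ?thesis using p n by simp
      qed
    qed (use finNP in auto)
    then obtain c where c: "0 < c" "\<And>p. p \<in> P \<Longrightarrow> - S p / p x < c"
      "\<And>n. n \<in> N \<Longrightarrow> n x < 0 \<Longrightarrow> c < S n / (- n x)" by auto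
    have "0 < (\<Sum>e\<in>insert x E. (w(x := c)) e * v e)" if v: "v \<in> V" for v
    proof -
      have "(\<Sum>e\<in>insert x E. (w(x := c)) e * v e) = c * v x + S v"
        using insert.hyps by (auto simp: S_def intro!: sum.cong)
      moreover have "0 < c * v x + S v"
      proof -
        consider "v \<in> P" | "v \<in> N" "v x < 0" | "v \<in> N" "v x = 0"
          using v by (force simp: P_def N_def)
        then show ?thesis
        proof cases
          case 1
          then have "0 < v x" by (simp add: P_def)
          then show ?thesis using c(2)[OF 1] by (simp add: field_simps)
        next
          case 2
          then have "c * (- v x) < S v" using c(3)[OF 2] by (subst (asm) less_divide_eq) simp
          then show ?thesis by simp
        next
          case 3
          then show ?thesis using SN by simp
        qed
      qed
      ultimately show ?thesis by simp
    qed
    moreover have "\<forall>e. 0 \<le> (w(x := c)) e" using w(1) c(1) by simp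
    ultimately show ?thesis by blast
  qed
qed

text \<open>The total coefficient is positive because the cone has no empty combination; this
  permits normalising it later.\<close>

lemma cone_coefficients:
  assumes "u \<in> cone V" and fin: "finite V"
  shows "\<exists>l. (\<forall>v. 0 \<le> l v) \<and> 0 < (\<Sum>v\<in>V. l v) \<and> (\<forall>e. u e = (\<Sum>v\<in>V. l v * v e))"
  using assms(1)
proof induction
  case (base v)
  have "(if v' = v then 1 else 0) * v' e = (if v' = v then v e else 0)" for v' :: "'a \<Rightarrow> real" and e by simp
  then show ?case
    using base fin by (intro exI[of _ "\<lambda>v'. if v' = v then 1 else 0"]) simp
next
  case (add u v)
  then obtain l l' where
    "\<forall>v. 0 \<le> l v" "0 < (\<Sum>v\<in>V. l v)" "\<forall>e. u e = (\<Sum>v\<in>V. l v * v e)"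
    "\<forall>v. 0 \<le> l' v" "0 < (\<Sum>v\<in>V. l' v)" "\<forall>e. v e = (\<Sum>v\<in>V. l' v * v e)" by blast
  then show ?case
    by (intro exI[of _ "\<lambda>v. l v + l' v"]) (auto simp: sum.distrib distrib_right)
next
  case (scale c u)
  then obtain l where
    "\<forall>v. 0 \<le> l v" "0 < (\<Sum>v\<in>V. l v)" "\<forall>e. u e = (\<Sum>v\<in>V. l v * v e)" by blast
  then show ?case
    using scale(1) by (intro exI[of _ "\<lambda>v. c * l v"]) (auto simp: sum_distrib_left[symmetric] mult.assoc)
qed

text \<open>Linear programming duality, from the alternative for the vectors
  \<open>L * of_bool (e \<in> A) - y e\<close> with \<open>A\<close> in \<open>\<A>\<close>. The
  assumption \<open>dual\<close> excludes weights positive on all of them, so some combination is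
  nonpositive on \<open>E\<close>; its coefficients, rescaled to total \<open>L\<close>, are the
  packing.\<close>

lemma fractional_packing:
  fixes y :: "'e \<Rightarrow> real"
  assumes fin: "finite E" and sub: "\<A> \<subseteq> Pow E" and L: "0 < L"
    and dual: "\<And>w. (\<And>e. 0 \<le> w e) \<Longrightarrow> \<exists>A\<in>\<A>. L * (\<Sum>e\<in>A. w e) \<le> (\<Sum>e\<in>E. w e * y e)"
  shows "\<exists>\<mu>. (\<forall>A. 0 \<le> \<mu> A) \<and> (\<Sum>A\<in>\<A>. \<mu> A) = L \<and> (\<forall>e\<in>E. (\<Sum>A\<in>{A\<in>\<A>. e \<in> A}. \<mu> A) \<le> y e)"
proof -
  have finA: "finite \<A>" using fin sub by (simp add: finite_subset)
  define vec where "vec A e = L * of_bool (e \<in> A) - y e" for A e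
  \<comment> \<open>Injectivity, which uses \<open>L \<noteq> 0\<close>, lets coefficients on
    vectors be read as coefficients on members of \<open>\<A>\<close>.\<close>
  have inj: "inj_on vec \<A>"
  proof (rule inj_onI)
    fix A B assume "vec A = vec B"
    then have "L * of_bool (e \<in> A) - y e = L * of_bool (e \<in> B) - y e" for e
      unfolding vec_def by (rule fun_cong)
    then have "(of_bool (e \<in> A) :: real) = of_bool (e \<in> B)" for e using L by simp
    then have "e \<in> A \<longleftrightarrow> e \<in> B" for e by (metis of_bool_eq_iff)
    then show "A = B" by blast
  qed
  have "\<not> (\<forall>v\<in>vec ` \<A>. 0 < (\<Sum>e\<in>E. w e * v e))" if w: "\<And>e. 0 \<le> w e" for w
  proof -
    obtain A where A: "A \<in> \<A>" "L * (\<Sum>e\<in>A. w e) \<le> (\<Sum>e\<in>E. w e * y e)" using dual[of w] w by blast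
    have "(\<Sum>e\<in>E. w e * of_bool (e \<in> A)) = (\<Sum>e\<in>A. w e)"
    proof -
      have "(\<Sum>e\<in>E. w e * of_bool (e \<in> A)) = (\<Sum>e\<in>A. w e * of_bool (e \<in> A))"
        by (rule sum.mono_neutral_right) (use fin A sub in auto)
      then show ?thesis by simp
    qed
    then have "(\<Sum>e\<in>E. w e * vec A e) = L * (\<Sum>e\<in>A. w e) - (\<Sum>e\<in>E. w e * y e)"
      by (simp add: vec_def right_diff_distrib sum_subtractf sum_distrib_left mult.left_commute
          flip: \<open>(\<Sum>e\<in>E. w e * of_bool (e \<in> A)) = (\<Sum>e\<in>A. w e)\<close>)
    then show ?thesis using A by force
  qed
  then obtain u where u: "u \<in> cone (vec ` \<A>)" "\<And>e. e \<in> E \<Longrightarrow> u e \<le> 0"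
    using Ville_alternative[OF fin, of "vec ` \<A>"] finA by blast
  obtain l where l: "\<And>v. 0 \<le> l v" "0 < (\<Sum>v\<in>vec ` \<A>. l v)" "\<And>e. u e = (\<Sum>v\<in>vec ` \<A>. l v * v e)"
    using cone_coefficients[OF u(1)] finA by blast
  define \<Lambda> where "\<Lambda> = (\<Sum>A\<in>\<A>. l (vec A))"
  have \<Lambda>: "0 < \<Lambda>" using l(2) inj by (simp add: \<Lambda>_def sum.reindex)
  have le: "L * (\<Sum>A\<in>{A\<in>\<A>. e \<in> A}. l (vec A)) \<le> \<Lambda> * y e" if "e \<in> E" for e
  proof -
    have "(\<Sum>A\<in>{A\<in>\<A>. e \<in> A}. l (vec A)) = (\<Sum>A\<in>\<A>. l (vec A) * of_bool (e \<in> A))"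
      using finA by (simp add: sum.inter_filter of_bool_def if_distrib cong: if_cong)
    then have "L * (\<Sum>A\<in>{A\<in>\<A>. e \<in> A}. l (vec A)) - \<Lambda> * y e = (\<Sum>A\<in>\<A>. l (vec A) * vec A e)"
      by (simp add: \<Lambda>_def vec_def right_diff_distrib sum_subtractf sum_distrib_left sum_distrib_right
          mult.left_commute)
    also have "\<dots> = u e" using l(3) inj by (simp add: sum.reindex)
    finally show ?thesis using u(2)[OF that] by simp
  qed
  show ?thesis
  proof (intro exI[of _ "\<lambda>A. L * l (vec A) / \<Lambda>"] conjI allI ballI)
    show "0 \<le> L * l (vec A) / \<Lambda>" for A using L l(1) \<Lambda> by simp
    show "(\<Sum>A\<in>\<A>. L * l (vec A) / \<Lambda>) = L"
      using \<Lambda> by (simp add: sum_divide_distrib[symmetric] sum_distrib_left[symmetric] flip: \<Lambda>_def)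
    show "(\<Sum>A\<in>{A\<in>\<A>. e \<in> A}. L * l (vec A) / \<Lambda>) \<le> y e" if "e \<in> E" for e
      using le[OF that] \<Lambda>
      by (simp add: sum_divide_distrib[symmetric] sum_distrib_left[symmetric] divide_le_eq mult.commute)
  qed
qed

section \<open>Clutters with a width--length inequality\<close>

text \<open>Rounding down loses less than \<open>1\<close> for each member of \<open>\<A>\<close>,
  and the summand \<open>card \<A>\<close> in the assumption \<open>q\<close> pays for this.\<close>

lemma packs_if_fractional:
  fixes y :: "'e \<Rightarrow> nat"
  assumes fin: "finite \<A>" and sub: "\<A> \<subseteq> Pow E" and \<mu>: "\<And>A. 0 \<le> \<mu> A"
    and q: "real (q + card \<A>) \<le> (\<Sum>A\<in>\<A>. \<mu> A)"
    and le: "\<And>e. e \<in> E \<Longrightarrow> (\<Sum>A\<in>{A\<in>\<A>. e \<in> A}. \<mu> A) \<le> real (y e)"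
  shows "packs \<A> q y"
  unfolding packs_def
proof (rule exI[of _ "\<lambda>A. nat \<lfloor>\<mu> A\<rfloor>"], intro conjI allI)
  have "(\<Sum>A\<in>\<A>. \<mu> A) \<le> (\<Sum>A\<in>\<A>. real (nat \<lfloor>\<mu> A\<rfloor>) + 1)"
    by (rule sum_mono) (use \<mu> in linarith)
  also have "\<dots> = real (\<Sum>A\<in>\<A>. nat \<lfloor>\<mu> A\<rfloor>) + real (card \<A>)" by (simp add: sum.distrib)
  finally have "real (q + card \<A>) \<le> real ((\<Sum>A\<in>\<A>. nat \<lfloor>\<mu> A\<rfloor>) + card \<A>)" using q by simp
  then show "q \<le> (\<Sum>A\<in>\<A>. nat \<lfloor>\<mu> A\<rfloor>)" unfolding of_nat_le_iff by simp
  fix e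
  show "(\<Sum>A\<in>{A\<in>\<A>. e \<in> A}. nat \<lfloor>\<mu> A\<rfloor>) \<le> y e"
  proof (cases "e \<in> E")
    case True
    have "real (\<Sum>A\<in>{A\<in>\<A>. e \<in> A}. nat \<lfloor>\<mu> A\<rfloor>) \<le> (\<Sum>A\<in>{A\<in>\<A>. e \<in> A}. \<mu> A)"
      unfolding of_nat_sum by (intro sum_mono of_nat_floor \<mu>)
    then have "real (\<Sum>A\<in>{A\<in>\<A>. e \<in> A}. nat \<lfloor>\<mu> A\<rfloor>) \<le> real (y e)" using le[OF True] by linarith
    then show ?thesis unfolding of_nat_le_iff .
  next
    case False
    then have *: "{A\<in>\<A>. e \<in> A} = {}" using sub by blast
    show ?thesis unfolding * by simp
  qed
qed

text \<open>A product of \<open>q\<close> generators has degree at least \<open>a * q\<close>;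
  formally, incidences between elements and packed members are counted in two ways.\<close>

lemma packs_degree_le:
  assumes fin: "finite E" and sub: "\<A> \<subseteq> Pow E" and a: "\<And>A. A \<in> \<A> \<Longrightarrow> a \<le> card A"
    and "packs \<A> q y"
  shows "a * q \<le> (\<Sum>e\<in>E. y e)"
proof -
  obtain N where N: "q \<le> (\<Sum>A\<in>\<A>. N A)" "\<And>e. (\<Sum>A\<in>{A\<in>\<A>. e \<in> A}. N A) \<le> y e"
    using assms(4) unfolding packs_def by blast
  have finA: "finite \<A>" using fin sub by (simp add: finite_subset)
  have "a * q \<le> (\<Sum>A\<in>\<A>. N A * a)" using N(1) by (simp add: sum_distrib_right[symmetric])
  also have "\<dots> \<le> (\<Sum>A\<in>\<A>. N A * card A)" by (intro sum_mono mult_left_mono a) auto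
  also have "\<dots> = (\<Sum>A\<in>\<A>. \<Sum>e\<in>{e\<in>E. e \<in> A}. N A)"
  proof (rule sum.cong[OF refl])
    fix A assume "A \<in> \<A>"
    then have "{e\<in>E. e \<in> A} = A" using sub by blast
    then show "N A * card A = (\<Sum>e\<in>{e\<in>E. e \<in> A}. N A)" by simp
  qed
  also have "\<dots> = (\<Sum>e\<in>E. \<Sum>A\<in>{A\<in>\<A>. e \<in> A}. N A)" by (rule sum.swap_restrict[OF finA fin])
  also have "\<dots> \<le> (\<Sum>e\<in>E. y e)" by (rule sum_mono) (rule N(2))
  finally show ?thesis .
qed

definition uniform_monom :: "'e set \<Rightarrow> nat \<Rightarrow> ('e \<Rightarrow>\<^sub>0 nat)" where
  "uniform_monom E d = (\<Sum>e\<in>E. Poly_Mapping.single e d)"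

lemma lookup_uniform_monom:
  "finite E \<Longrightarrow> Poly_Mapping.lookup (uniform_monom E d) e = (if e \<in> E then d else 0)"
  by (simp add: uniform_monom_def lookup_sum lookup_single when_def)

lemma keys_uniform_monom: "finite E \<Longrightarrow> Poly_Mapping.keys (uniform_monom E d) \<subseteq> E"
  by (auto simp: in_keys_iff lookup_uniform_monom split: if_splits)

text \<open>Common interface for the bases and for the cocircuits. The bound in
  \<open>width_length\<close> is the value reached by the constants \<open>1 / c\<close> for
  \<open>y\<close> and \<open>1 / a\<close> for \<open>z\<close>, which satisfy the constraints by
  \<open>card_C\<close> and \<open>card_A\<close>.\<close>

locale paired_clutter =
  fixes E :: "'e set" and \<A> :: "'e set set" and a c :: nat
  assumes fin: "finite E" and sub: "\<A> \<subseteq> Pow E"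
    and a_pos: "0 < a" and c_pos: "0 < c"
    and card_A: "A \<in> \<A> \<Longrightarrow> a \<le> card A" and ex_card_A: "\<exists>A\<in>\<A>. card A = a"
    and card_C: "C \<in> blocker E \<A> \<Longrightarrow> c \<le> card C"
    and width_length: "\<lbrakk>\<And>e. 0 \<le> y e; \<And>e. 0 \<le> z e; \<And>C. C \<in> blocker E \<A> \<Longrightarrow> 1 \<le> (\<Sum>e\<in>C. y e);
        \<And>A. A \<in> \<A> \<Longrightarrow> 1 \<le> (\<Sum>e\<in>A. z e)\<rbrakk>
      \<Longrightarrow> real (card E) / (real a * real c) \<le> (\<Sum>e\<in>E. y e * (z e :: real))"
begin

lemma finA: "finite \<A>"
  using fin sub by (simp add: finite_subset)

lemma card_E_pos: "0 < card E"
proof -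
  obtain A where "A \<in> \<A>" "card A = a" using ex_card_A by blast
  then show ?thesis using sub a_pos fin by (metis PowD card_gt_0_iff card_mono gr_zeroI le_zero_eq subsetD)
qed

abbreviation I :: "('e, 'k::field) mpoly set" where
  "I \<equiv> monomial_ideal E {m. \<exists>A\<in>\<A>. A \<subseteq> Poly_Mapping.keys m}"

abbreviation symb :: "nat \<Rightarrow> ('e \<Rightarrow>\<^sub>0 nat) set" where
  "symb s \<equiv> {m. \<forall>C\<in>blocker E \<A>. s \<le> (\<Sum>e\<in>C. Poly_Mapping.lookup m e)}"

lemma initial_degree_I: "initial_degree (I :: ('e, 'k::field) mpoly set) = a"
proof (rule antisym)
  let ?U = "{m :: 'e \<Rightarrow>\<^sub>0 nat. \<exists>A\<in>\<A>. A \<subseteq> Poly_Mapping.keys m}"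
  obtain A where A: "A \<in> \<A>" "card A = a" using ex_card_A by blast
  have AE: "A \<subseteq> E" "finite A" using A sub fin finite_subset by blast+
  have m: "indicator_monom A \<in> ?U" "Poly_Mapping.keys (indicator_monom A) \<subseteq> E"
    using A AE by (auto simp: keys_indicator_monom)
  have "E \<inter> A = A" using AE by blast
  then have "(\<Sum>e\<in>E. Poly_Mapping.lookup (indicator_monom A) e) = a"
    using fin A AE by (simp add: lookup_indicator_monom sum.If_cases Int_def[symmetric])
  then show "initial_degree (I :: ('e, 'k) mpoly set) \<le> a"
    using initial_degree_le[OF fin m] by metis
  obtain u where u: "u \<in> ?U" "Poly_Mapping.keys u \<subseteq> E"
    "initial_degree (I :: ('e, 'k) mpoly set) = (\<Sum>e\<in>E. Poly_Mapping.lookup u e)"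
    by (rule initial_degree_attained[OF fin m])
  then obtain B where B: "B \<in> \<A>" "B \<subseteq> Poly_Mapping.keys u" by blast
  have BE: "B \<subseteq> E" using B sub by blast
  have "a \<le> (\<Sum>e\<in>B. 1)" using card_A[OF B(1)] by simp
  also have "\<dots> \<le> (\<Sum>e\<in>B. Poly_Mapping.lookup u e)"
    using B(2) by (intro sum_mono) (auto simp: in_keys_iff Suc_le_eq)
  also have "\<dots> \<le> (\<Sum>e\<in>E. Poly_Mapping.lookup u e)"
    by (rule sum_mono2[OF fin BE]) simp
  finally show "a \<le> initial_degree (I :: ('e, 'k) mpoly set)" using u by simp
qed

lemma symbolic_power_I:
  "symbolic_power (poly_ring (K :: 'k::field itself) E) I s = monomial_ideal E (symb s)"
  by (rule symbolic_power_sqfree[OF fin sub])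

lemma uniform_monom_in_symb:
  assumes "s \<le> c * d"
  shows "uniform_monom E d \<in> symb s"
proof (intro CollectI ballI)
  fix C assume C: "C \<in> blocker E \<A>"
  then have "C \<subseteq> E" by (simp add: blocker_def)
  then have "(\<Sum>e\<in>C. Poly_Mapping.lookup (uniform_monom E d) e) = (\<Sum>e\<in>C. d)"
    by (intro sum.cong) (auto simp: lookup_uniform_monom[OF fin])
  also have "\<dots> \<ge> c * d" using card_C[OF C] by simp
  finally show "s \<le> (\<Sum>e\<in>C. Poly_Mapping.lookup (uniform_monom E d) e)" using assms by simp
qed

lemma sum_uniform_monom: "(\<Sum>e\<in>E. Poly_Mapping.lookup (uniform_monom E d) e) = card E * d"
  by (simp add: lookup_uniform_monom[OF fin])

text \<open>The width-length inequality for \<open>y = u / s\<close> and the constant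
  \<open>z = 1 / a\<close>.\<close>

lemma symb_degree_ge:
  assumes u: "u \<in> symb s" and s: "0 < s"
  shows "real (card E) / real c * real s \<le> real (\<Sum>e\<in>E. Poly_Mapping.lookup u e)"
proof -
  have "real (card E) / (real a * real c)
      \<le> (\<Sum>e\<in>E. (real (Poly_Mapping.lookup u e) / real s) * (1 / real a))"
  proof (rule width_length)
    fix C assume "C \<in> blocker E \<A>"
    then have "s \<le> (\<Sum>e\<in>C. Poly_Mapping.lookup u e)" using u by blast
    then have "real s \<le> real (\<Sum>e\<in>C. Poly_Mapping.lookup u e)" unfolding of_nat_le_iff .
    then show "1 \<le> (\<Sum>e\<in>C. real (Poly_Mapping.lookup u e) / real s)"
      using s by (simp add: sum_divide_distrib[symmetric])
  next
    fix A assume "A \<in> \<A>"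
    then show "1 \<le> (\<Sum>e\<in>A. 1 / real a)" using card_A[of A] a_pos by simp
  qed simp_all
  then have *: "real (card E) / (real a * real c) \<le> real (\<Sum>e\<in>E. Poly_Mapping.lookup u e) / (real s * real a)"
    by (simp add: sum_divide_distrib[symmetric])
  show ?thesis
    using mult_right_mono[OF *, of "real s * real a"] s a_pos c_pos by (simp add: field_simps)
qed

lemma waldschmidt_I:
  "waldschmidt (poly_ring (K :: 'k::field itself) E) I = real (card E) / real c"
proof -
  let ?n = "real (card E)"
  let ?\<alpha> = "\<lambda>s. initial_degree (symbolic_power (poly_ring K E) I s)"
  have bounds: "?n / c \<le> ?\<alpha> s / s \<and> ?\<alpha> s / s \<le> ?n / c + ?n / s" if s: "0 < s" for s
  proof
    \<comment> \<open>A constant exponent exceeding \<open>s / c\<close> by at most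
      \<open>1\<close>; the excess costs \<open>n / s\<close> after division by \<open>s\<close> and
      vanishes in the limit.\<close>
    let ?d = "s div c + 1"
    have "s \<le> c * ?d"
      using c_pos by (metis add.commute distrib_left dividend_less_times_div less_imp_le mult.right_neutral)
    note U = uniform_monom_in_symb[OF this]
    note k = keys_uniform_monom[OF fin, of ?d]
    obtain u where u: "u \<in> symb s" "Poly_Mapping.keys u \<subseteq> E" "?\<alpha> s = (\<Sum>e\<in>E. Poly_Mapping.lookup u e)"
      unfolding symbolic_power_I by (rule initial_degree_attained[OF fin U k])
    show "?n / c \<le> ?\<alpha> s / s"
      using symb_degree_ge[OF u(1) s] u(3) s by (simp add: le_divide_eq)
    have "?\<alpha> s \<le> card E * ?d"
      unfolding symbolic_power_I using initial_degree_le[OF fin U k] by (simp only: sum_uniform_monom)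
    then have "real (?\<alpha> s) \<le> ?n * real ?d" unfolding of_nat_mult[symmetric] of_nat_le_iff .
    also have "\<dots> \<le> ?n * (real s / real c + 1)"
      using of_nat_div_le_of_nat[of s c, where 'a = real] by (intro mult_left_mono) auto
    finally have "?\<alpha> s / s \<le> ?n * (real s / real c + 1) / s" using s by (simp add: divide_right_mono)
    also have "\<dots> = ?n / c + ?n / s" using s c_pos by (simp add: field_simps)
    finally show "?\<alpha> s / s \<le> ?n / c + ?n / s" .
  qed
  have "(\<lambda>s. ?\<alpha> s / s) \<longlonglongrightarrow> ?n / c"
  proof (rule tendsto_sandwich)
    show "\<forall>\<^sub>F s in sequentially. ?n / c \<le> ?\<alpha> s / s"
      using eventually_gt_at_top[of 0] by eventually_elim (use bounds in blast)
    show "\<forall>\<^sub>F s in sequentially. ?\<alpha> s / s \<le> ?n / c + ?n / s"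
      using eventually_gt_at_top[of 0] by eventually_elim (use bounds in blast)
    have "(\<lambda>s. ?n / c + ?n / real s) \<longlonglongrightarrow> ?n / c + 0"
      by (intro tendsto_intros lim_const_over_n)
    then show "(\<lambda>s. ?n / c + ?n / real s) \<longlonglongrightarrow> ?n / c" by simp
  qed simp
  then show ?thesis unfolding waldschmidt_def by (rule limI)
qed

text \<open>The width-length inequality is the dual condition for a fractional packing of total
  weight \<open>L\<close> into any exponent vector of the symbolic power; the reserve
  \<open>card \<A>\<close> covers the rounding.\<close>

lemma symbolic_subset_power:
  assumes s: "0 < s" and q: "real (q + card \<A>) \<le> real s * (real (card E) / (real a * real c))"
  shows "symbolic_power (poly_ring (K :: 'k::field itself) E) I s \<subseteq> ideal_power (poly_ring K E) I q"
proof -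
  define L where "L = real s * (real (card E) / (real a * real c))"
  have L: "0 < L" using s card_E_pos a_pos c_pos by (simp add: L_def)
  have "packs \<A> q (Poly_Mapping.lookup m)" if m: "m \<in> symb s" for m
  proof -
    let ?y = "\<lambda>e. real (Poly_Mapping.lookup m e)"
    have "\<exists>\<mu>. (\<forall>A. 0 \<le> \<mu> A) \<and> (\<Sum>A\<in>\<A>. \<mu> A) = L \<and> (\<forall>e\<in>E. (\<Sum>A\<in>{A\<in>\<A>. e \<in> A}. \<mu> A) \<le> ?y e)"
    proof (rule fractional_packing[OF fin sub L])
      fix w :: "'e \<Rightarrow> real" assume w: "\<And>e. 0 \<le> w e"
      show "\<exists>A\<in>\<A>. L * (\<Sum>e\<in>A. w e) \<le> (\<Sum>e\<in>E. w e * ?y e)"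
      proof (rule ccontr)
        assume "\<not> ?thesis"
        then have gt: "(\<Sum>e\<in>E. w e * ?y e) < L * (\<Sum>e\<in>A. w e)" if "A \<in> \<A>" for A
          using that by force
        \<comment> \<open>The weight of a lightest member. Dividing \<open>w\<close> by it yields a
          function of weight at least \<open>1\<close> on every member, as
          \<open>width_length\<close> requires.\<close>
        define \<beta> where "\<beta> = Min ((\<lambda>A. \<Sum>e\<in>A. w e) ` \<A>)"
        have "\<A> \<noteq> {}" using ex_card_A by blast
        then have "\<beta> \<in> (\<lambda>A. \<Sum>e\<in>A. w e) ` \<A>" unfolding \<beta>_def using finA by (intro Min_in) auto
        then obtain A0 where A0: "A0 \<in> \<A>" "\<beta> = (\<Sum>e\<in>A0. w e)" by blast
        have min: "\<beta> \<le> (\<Sum>e\<in>A. w e)" if "A \<in> \<A>" for A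
          unfolding \<beta>_def using finA that by (intro Min_le) auto
        have "0 \<le> (\<Sum>e\<in>E. w e * ?y e)" using w by (intro sum_nonneg) simp
        \<comment> \<open>The strict failure of the claim at \<open>A0\<close> already forces
          \<open>\<beta>\<close> to be nonzero.\<close>
        then have "0 < L * \<beta>" using gt[OF A0(1)] A0(2) by simp
        then have \<beta>: "0 < \<beta>" using L by (simp add: zero_less_mult_iff)
        have "real (card E) / (real a * real c) \<le> (\<Sum>e\<in>E. ?y e / s * (w e / \<beta>))"
        proof (rule width_length)
          fix C assume "C \<in> blocker E \<A>"
          then have "s \<le> (\<Sum>e\<in>C. Poly_Mapping.lookup m e)" using m by blast
          then have "real s \<le> real (\<Sum>e\<in>C. Poly_Mapping.lookup m e)" unfolding of_nat_le_iff .
          then show "1 \<le> (\<Sum>e\<in>C. ?y e / s)" using s by (simp add: sum_divide_distrib[symmetric])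
        next
          fix A assume "A \<in> \<A>"
          then show "1 \<le> (\<Sum>e\<in>A. w e / \<beta>)" using min \<beta> by (simp add: sum_divide_distrib[symmetric])
        qed (use w \<beta> in simp_all)
        also have "\<dots> = (\<Sum>e\<in>E. w e * ?y e) / (s * \<beta>)"
          by (simp add: sum_divide_distrib mult.commute)
        also have "\<dots> < L * \<beta> / (s * \<beta>)"
          using gt[OF A0(1)] A0(2) s \<beta> by (intro divide_strict_right_mono) auto
        also have "\<dots> = real (card E) / (real a * real c)" using s \<beta> by (simp add: L_def)
        finally show False by simp
      qed
    qed
    then obtain \<mu> where "\<And>A. 0 \<le> \<mu> A" "(\<Sum>A\<in>\<A>. \<mu> A) = L"
      "\<And>e. e \<in> E \<Longrightarrow> (\<Sum>A\<in>{A\<in>\<A>. e \<in> A}. \<mu> A) \<le> ?y e" by blast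
    then show ?thesis using q by (intro packs_if_fractional[OF finA sub, of \<mu>]) (auto simp: L_def)
  qed
  then show ?thesis
    unfolding symbolic_power_I ideal_power_sqfree[OF fin sub] by (intro monomial_ideal_mono) blast
qed

text \<open>Above the ratio \<open>a * c / n\<close> the containment eventually holds, since the
  rounding loss is constant while the surplus grows with \<open>t\<close>. Below it, constant
  exponent vectors violate the containment by degree, for ratios arbitrarily close to the
  bound.\<close>

lemma asymptotic_resurgence_I:
  "asymptotic_resurgence (poly_ring (K :: 'k::field itself) E) I
     = real a * real c / real (card E)"
proof -
  let ?n = "card E"
  let ?\<rho> = "real a * real c / real ?n"
  define S where "S = {real s / real r | s r. s > 0 \<and> r > 0 \<and>
    (\<forall>\<^sub>F t in sequentially. \<not> symbolic_power (poly_ring K E) I (s * t) \<subseteq> ideal_power (poly_ring K E) I (r * t))}"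
  have upper: "x \<le> ?\<rho>" if x: "x \<in> S" for x
  proof (rule ccontr)
    assume "\<not> x \<le> ?\<rho>"
    from x obtain s r where sr: "x = real s / real r" "s > 0" "r > 0"
      and ev: "\<forall>\<^sub>F t in sequentially. \<not> symbolic_power (poly_ring K E) I (s * t) \<subseteq> ideal_power (poly_ring K E) I (r * t)"
      unfolding S_def by blast
    \<comment> \<open>The surplus of fractional packing weight per unit of \<open>t\<close>; it is
      positive exactly when \<open>s / r\<close> exceeds the claimed value.\<close>
    define \<delta> where "\<delta> = real s * (real ?n / (real a * real c)) - real r"
    have "0 < \<delta>"
      using \<open>\<not> x \<le> ?\<rho>\<close> sr card_E_pos a_pos c_pos by (simp add: \<delta>_def not_le field_simps)
    have "\<forall>\<^sub>F t in sequentially. real (card \<A>) / \<delta> \<le> real t"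
      by (rule eventually_sequentiallyI[of "nat \<lceil>real (card \<A>) / \<delta>\<rceil>"]) linarith
    with ev eventually_gt_at_top[of 0]
    have "\<forall>\<^sub>F t :: nat in sequentially. False"
    proof eventually_elim
      case (elim t)
      have "real (card \<A>) \<le> \<delta> * real t" using elim(3) \<open>0 < \<delta>\<close> by (simp add: divide_le_eq mult.commute)
      then have "real (r * t + card \<A>) \<le> real (s * t) * (real ?n / (real a * real c))"
        by (simp add: \<delta>_def algebra_simps)
      then show ?case using symbolic_subset_power[of "s * t" "r * t" K] elim(1,2) sr(2) by simp
    qed
    then show False by simp
  qed
  have lower: "real c * real a / (real ?n + inverse (real (Suc i))) \<in> S" for i
  proof -
    \<comment> \<open>Without the \<open>+ 1\<close> in \<open>?r\<close> the ratio would equal the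
      claimed value; this smallest increase puts it just below, and the ratios converge to the value
      as \<open>i\<close> grows.\<close>
    let ?s = "c * a * Suc i" and ?r = "?n * Suc i + 1"
    have "\<not> symbolic_power (poly_ring K E) I (?s * t) \<subseteq> ideal_power (poly_ring K E) I (?r * t)"
      if t: "0 < t" for t
    proof
      assume sub': "symbolic_power (poly_ring K E) I (?s * t) \<subseteq> ideal_power (poly_ring K E) I (?r * t)"
      \<comment> \<open>Its degree is \<open>n * a * Suc i * t\<close>, short by
        \<open>a * t\<close> of the least degree in the power \<open>?r * t\<close>.\<close>
      define m where "m = uniform_monom E (a * Suc i * t)"
      have "m \<in> symb (?s * t)" unfolding m_def by (rule uniform_monom_in_symb) (simp add: algebra_simps)
      moreover have "Poly_Mapping.keys m \<subseteq> E" unfolding m_def by (rule keys_uniform_monom[OF fin])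
      ultimately have "Poly_Mapping.single m (1 :: 'k) \<in> symbolic_power (poly_ring K E) I (?s * t)"
        unfolding symbolic_power_I single_mem_monomial_ideal_iff by blast
      then have "Poly_Mapping.single m (1 :: 'k) \<in> ideal_power (poly_ring K E) I (?r * t)" using sub' by blast
      then have "packs \<A> (?r * t) (Poly_Mapping.lookup m)"
        unfolding ideal_power_sqfree[OF fin sub] single_mem_monomial_ideal_iff by blast
      then have "a * (?r * t) \<le> ?n * (a * Suc i * t)"
        using packs_degree_le[OF fin sub card_A] sum_uniform_monom unfolding m_def by metis
      then have "a * t + ?n * (a * Suc i * t) \<le> ?n * (a * Suc i * t)" by (simp add: algebra_simps)
      then show False using a_pos t by simp
    qed
    then have "\<forall>\<^sub>F t in sequentially. \<not> symbolic_power (poly_ring K E) I (?s * t) \<subseteq> ideal_power (poly_ring K E) I (?r * t)"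
      using eventually_gt_at_top[of 0] by (rule eventually_mono[rotated])
    moreover have "?s > 0" "?r > 0" using a_pos c_pos by auto
    ultimately have "real ?s / real ?r \<in> S"
      unfolding S_def by (intro CollectI exI[of _ ?s] exI[of _ ?r] conjI refl)
    moreover have "real ?s / real ?r = real c * real a / (real ?n + inverse (real (Suc i)))"
    proof -
      have "real ?r = (real ?n + inverse (real (Suc i))) * real (Suc i)"
        by (simp add: field_simps)
      then show ?thesis by (simp only: of_nat_mult) simp
    qed
    ultimately show ?thesis by simp
  qed
  have "Sup S = ?\<rho>"
  proof (rule antisym)
    show "Sup S \<le> ?\<rho>" using lower upper by (intro cSup_least) auto
    have "bdd_above S" using upper by (auto simp: bdd_above_def)
    then have le: "real c * real a / (real ?n + inverse (real (Suc i))) \<le> Sup S" for i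
      using lower by (intro cSup_upper)
    have "(\<lambda>i. real c * real a / (real ?n + inverse (real (Suc i)))) \<longlonglongrightarrow> real c * real a / (real ?n + 0)"
      using card_E_pos by (intro tendsto_intros LIMSEQ_inverse_real_of_nat) auto
    then show "?\<rho> \<le> Sup S" using le by (auto intro: LIMSEQ_le_const2 simp: mult.commute)
  qed
  then show ?thesis unfolding asymptotic_resurgence_def S_def .
qed

end

section \<open>Steiner systems\<close>

text \<open>Discarding a lightest element does not lower the average weight, and this is repeated
  until \<open>p\<close> elements remain. The cross-multiplied form also covers
  \<open>p = 0\<close>.\<close>

lemma ex_heavy_subset:
  fixes y :: "'e \<Rightarrow> real"
  assumes "finite X" and "p \<le> card X"
  shows "\<exists>A\<subseteq>X. card A = p \<and> real p * (\<Sum>e\<in>X. y e) \<le> real (card X) * (\<Sum>e\<in>A. y e)"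
  using assms
proof (induction "card X" arbitrary: X)
  case 0
  then show ?case by auto
next
  case (Suc N)
  show ?case
  proof (cases "p = card X")
    case True
    then show ?thesis by blast
  next
    case False
    have "X \<noteq> {}" using Suc.hyps(2) by auto
    then have "Min (y ` X) \<in> y ` X" "\<forall>e\<in>X. Min (y ` X) \<le> y e" using Suc.prems(1) by auto
    then obtain x where x: "x \<in> X" "\<And>e. e \<in> X \<Longrightarrow> y x \<le> y e" by auto
    have N: "card (X - {x}) = N" using Suc.hyps(2) Suc.prems(1) x(1) by simp
    obtain A where A: "A \<subseteq> X - {x}" "card A = p"
      and le: "real p * (\<Sum>e\<in>X - {x}. y e) \<le> real (card (X - {x})) * (\<Sum>e\<in>A. y e)"
      using Suc.hyps(1)[of "X - {x}"] N Suc.prems Suc.hyps(2) False by auto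
    have "real p * y x = (\<Sum>e\<in>A. y x)" using A by simp
    also have "\<dots> \<le> (\<Sum>e\<in>A. y e)" using A x(2) by (intro sum_mono) auto
    finally have "real p * y x + real p * (\<Sum>e\<in>X - {x}. y e) \<le> (\<Sum>e\<in>A. y e) + real N * (\<Sum>e\<in>A. y e)"
      using le N by simp
    also have "\<dots> = real (card X) * (\<Sum>e\<in>A. y e)" using Suc.hyps(2)[symmetric] by (simp add: distrib_right)
    finally have "real p * (\<Sum>e\<in>X. y e) \<le> real (card X) * (\<Sum>e\<in>A. y e)"
      using sum.remove[OF Suc.prems(1) x(1), of y] by (simp add: distrib_left)
    then show ?thesis using A by blast
  qed
qed

text \<open>Abel summation: increments of the sorted values \<open>z\<close> multiply nonnegative
  tail sums of \<open>d\<close>. The induction carries a lower bound \<open>c\<close> for the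
  remaining values.\<close>

lemma sorted_tail_sums_le:
  fixes d z :: "'e \<Rightarrow> real"
  assumes "sorted (map z xs)" and "\<And>i. 0 \<le> sum_list (map d (drop i xs))" and "\<And>x. x \<in> set xs \<Longrightarrow> c \<le> z x"
  shows "c * sum_list (map d xs) \<le> sum_list (map (\<lambda>x. d x * z x) xs)"
  using assms
proof (induction xs arbitrary: c)
  case Nil
  then show ?case by simp
next
  case (Cons x xs)
  have tails: "0 \<le> sum_list (map d (drop i xs))" for i using Cons.prems(2)[of "Suc i"] by simp
  \<comment> \<open>The factor may be raised from \<open>c\<close> to \<open>z x\<close> because the
    full sum is itself a nonnegative tail.\<close>
  have "c * sum_list (map d (x # xs)) \<le> z x * sum_list (map d (x # xs))"
    using Cons.prems(2)[of 0] Cons.prems(3)[of x] by (intro mult_right_mono) auto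
  also have "\<dots> = d x * z x + z x * sum_list (map d xs)" by (simp add: distrib_left mult.commute)
  also have "\<dots> \<le> d x * z x + sum_list (map (\<lambda>x. d x * z x) xs)"
    using Cons.IH[OF _ tails, of "z x"] Cons.prems(1) by simp
  finally show ?case by simp
qed

text \<open>A subset of the ground set is independent in the dual exactly when it is disjoint from
  some basis, so dependence in the dual means meeting all bases.\<close>

lemma circuits_dual_matroid:
  "circuits (dual_matroid M) = blocker (ground M) (bases M)"
proof -
  have "indep (dual_matroid M) X \<longleftrightarrow> (\<exists>B\<in>bases M. B \<inter> X = {})" if "X \<subseteq> ground M" for X
    using that unfolding indep_def dual_matroid_def by auto
  then have char: "\<not> indep (dual_matroid M) C \<and> (\<forall>D. D \<subset> C \<longrightarrow> indep (dual_matroid M) D) \<longleftrightarrow>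
      (\<forall>B\<in>bases M. B \<inter> C \<noteq> {}) \<and> (\<forall>D. D \<subset> C \<longrightarrow> (\<exists>B\<in>bases M. B \<inter> D = {}))"
    if "C \<subseteq> ground M" for C
    using that by (metis (no_types, lifting) psubset_imp_subset subset_trans)
  have "ground (dual_matroid M) = ground M" by (simp add: dual_matroid_def)
  then show ?thesis
    unfolding circuits_def blocker_def by (simp only: char cong: conj_cong)
qed

section \<open>Steiner systems: blocks and codimension\<close>

locale steiner =
  fixes t k n :: nat and E :: "'e set" and Bl :: "'e set set"
  assumes steiner_system: "steiner_system t k n E Bl"
    and t_pos: "1 \<le> t" and t_less: "t < k" and k_less: "k < n"
begin

lemma fin: "finite E" and card_E: "card E = n"
  using steiner_system by (auto simp: steiner_system_def)

lemma block_subset: "B \<in> Bl \<Longrightarrow> B \<subseteq> E" and card_block: "B \<in> Bl \<Longrightarrow> card B = k"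
  using steiner_system by (auto simp: steiner_system_def)

lemma finite_block: "B \<in> Bl \<Longrightarrow> finite B"
  using block_subset fin finite_subset by blast

lemma finite_Bl: "finite Bl"
  using block_subset fin by (metis finite_Pow_iff finite_subset PowI subsetI)

lemma block_unique:
  assumes "B \<in> Bl" "B' \<in> Bl" "X \<subseteq> B" "X \<subseteq> B'" "t \<le> card X"
  shows "B = B'"
proof -
  obtain T where T: "T \<subseteq> X" "card T = t" using obtain_subset_with_card_n[OF assms(5)] by blast
  then have "T \<subseteq> E" using assms block_subset by blast
  then have "\<exists>!B. B \<in> Bl \<and> T \<subseteq> B" using steiner_system T(2) by (simp add: steiner_system_def)
  moreover have "T \<subseteq> B" "T \<subseteq> B'" using T assms by auto
  ultimately show ?thesis using assms(1,2) by (metis (no_types))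
qed

lemma ex_block:
  assumes "X \<subseteq> E" "card X \<le> t"
  shows "\<exists>B\<in>Bl. X \<subseteq> B"
proof -
  have "t \<le> card E" using card_E t_less k_less by simp
  then obtain T where T: "X \<subseteq> T" "T \<subseteq> E" "card T = t"
    using exists_subset_between[OF assms(2) _ assms(1) fin] by blast
  then have "\<exists>!B. B \<in> Bl \<and> T \<subseteq> B" using steiner_system by (simp add: steiner_system_def)
  then show ?thesis using T(1) by blast
qed

text \<open>A block through a point outside \<open>B0\<close> shares fewer than \<open>t\<close>
  points with \<open>B0\<close>, so more than \<open>k - t\<close> of its points lie in the
  complement of \<open>B0\<close>.\<close>

lemma codim_ge: "k - t + 1 \<le> n - k"
proof -
  obtain B0 where B0: "B0 \<in> Bl" using ex_block[of "{}"] by auto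
  have "B0 \<noteq> E" using card_block[OF B0] card_E k_less by auto
  then obtain e where e: "e \<in> E" "e \<notin> B0" using block_subset[OF B0] by blast
  obtain B1 where B1: "B1 \<in> Bl" "e \<in> B1" using ex_block[of "{e}"] e t_pos by auto
  have "B0 \<noteq> B1" using e B1 by blast
  then have less: "card (B0 \<inter> B1) < t" using block_unique[OF B0 B1(1), of "B0 \<inter> B1"] by force
  have "k = card (B0 \<inter> B1) + card (B1 - B0)"
    using card_block[OF B1(1)] card_Int_Diff[OF finite_block[OF B1(1)], of B0] by (simp add: Int_commute)
  moreover have "card (B1 - B0) \<le> card (E - B0)"
    using fin block_subset[OF B1(1)] by (intro card_mono) auto
  moreover have "card (E - B0) = n - k"
    using card_Diff_subset[OF finite_block[OF B0] block_subset[OF B0]] card_E card_block[OF B0] by simp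
  ultimately show ?thesis using less t_less by arith
qed

section \<open>Counting the blocks through a set\<close>

definition blocks_through :: "'e set \<Rightarrow> 'e set set" where
  "blocks_through F = {B\<in>Bl. F \<subseteq> B}"

lemma finite_blocks_through: "finite (blocks_through F)"
  using finite_Bl by (simp add: blocks_through_def)

lemma double_count:
  assumes "F \<subseteq> E"
  shows "(\<Sum>e\<in>E - F. card (blocks_through (insert e F))) = card (blocks_through F) * (k - card F)"
proof -
  have finF: "finite F" using assms fin finite_subset by blast
  have eq: "blocks_through (insert e F) = {B\<in>blocks_through F. e \<in> B}" for e
    by (auto simp: blocks_through_def)
  have "(\<Sum>e\<in>E - F. card (blocks_through (insert e F))) = (\<Sum>e\<in>E - F. \<Sum>B\<in>{B\<in>blocks_through F. e \<in> B}. 1)"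
    by (simp add: eq)
  also have "\<dots> = (\<Sum>B\<in>blocks_through F. \<Sum>e\<in>{e\<in>E - F. e \<in> B}. 1)"
    by (rule sum.swap_restrict[OF _ finite_blocks_through]) (use fin in auto)
  also have "\<dots> = (\<Sum>B\<in>blocks_through F. k - card F)"
  proof (rule sum.cong[OF refl])
    fix B assume "B \<in> blocks_through F"
    then have B: "B \<in> Bl" "F \<subseteq> B" by (auto simp: blocks_through_def)
    then have "{e\<in>E - F. e \<in> B} = B - F" using block_subset by blast
    then show "(\<Sum>e\<in>{e\<in>E - F. e \<in> B}. 1) = k - card F"
      using B card_block card_Diff_subset[OF finF] by simp
  qed
  finally show ?thesis by simp
qed

text \<open>Induction downwards from sets of size \<open>t\<close>, which lie in exactly one block.
  Double counting passes from each size to the next smaller one; the quotient is exact since its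
  divisor \<open>k - card F\<close> is positive.\<close>

lemma blocks_through_regular:
  "i \<le> t \<Longrightarrow> \<exists>l. \<forall>F. F \<subseteq> E \<and> card F = t - i \<longrightarrow> card (blocks_through F) = l"
proof (induction i)
  case 0
  have "card (blocks_through F) = 1" if "F \<subseteq> E" "card F = t" for F
  proof -
    have "\<exists>!B. B \<in> Bl \<and> F \<subseteq> B" using steiner_system that by (simp add: steiner_system_def)
    then obtain B where "blocks_through F = {B}" unfolding blocks_through_def by blast
    then show ?thesis by simp
  qed
  then show ?case by auto
next
  case (Suc i)
  then obtain l where l: "\<And>F. F \<subseteq> E \<Longrightarrow> card F = t - i \<Longrightarrow> card (blocks_through F) = l" by auto
  have "card (blocks_through F) = (n - (t - Suc i)) * l div (k - (t - Suc i))"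
    if F: "F \<subseteq> E" "card F = t - Suc i" for F
  proof -
    have finF: "finite F" using F fin finite_subset by blast
    have "card (blocks_through (insert e F)) = l" if "e \<in> E - F" for e
      using that F finF Suc.prems by (intro l) auto
    then have "(\<Sum>e\<in>E - F. card (blocks_through (insert e F))) = card (E - F) * l" by simp
    moreover have "card (E - F) = n - (t - Suc i)" using card_Diff_subset[OF finF F(1)] card_E F(2) by simp
    ultimately have "(n - (t - Suc i)) * l = card (blocks_through F) * (k - (t - Suc i))"
      using double_count[OF F(1)] F(2) by simp
    then show ?thesis using t_less by simp
  qed
  then show ?case by blast
qed

text \<open>The inequality \<open>y\<close> is summed over the blocks through \<open>F\<close>.
  Every point outside \<open>F\<close> is missed by the same number \<open>card ?D - l\<close> of
  them, and by double counting \<open>(n - j) * (card ?D - l) = card ?D * (n - k)\<close> for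
  \<open>j = card F\<close>.\<close>

lemma design_bound:
  fixes y :: "'e \<Rightarrow> real"
  assumes F: "F \<subseteq> E" "card F < t"
    and y: "\<And>B. B \<in> Bl \<Longrightarrow> 1 \<le> (\<Sum>e\<in>E - B. y e)"
  shows "real (n - card F) \<le> real (n - k) * (\<Sum>e\<in>E - F. y e)"
proof -
  let ?j = "card F" and ?D = "blocks_through F"
  have finF: "finite F" using F fin finite_subset by blast
  have cEF: "card (E - F) = n - ?j" using card_Diff_subset[OF finF F(1)] card_E by simp
  \<comment> \<open>Since \<open>?j < t\<close>, the size \<open>t - (t - Suc ?j)\<close> is
    \<open>Suc ?j\<close>, so \<open>l\<close> counts the blocks through \<open>F\<close> and one
    further point.\<close>
  obtain l where l: "\<And>F. F \<subseteq> E \<Longrightarrow> card F = t - (t - Suc ?j) \<Longrightarrow> card (blocks_through F) = l"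
    using blocks_through_regular[of "t - Suc ?j"] by auto
  have l': "card (blocks_through (insert e F)) = l" if "e \<in> E - F" for e
    using that F finF by (intro l) auto
  have count: "card ?D * (k - ?j) = (n - ?j) * l" using double_count[OF F(1)] l' cEF by simp
  have D_pos: "0 < card ?D"
    using ex_block[OF F(1)] F(2) finite_blocks_through by (auto simp: card_gt_0_iff blocks_through_def)
  have miss: "real (card {B\<in>?D. e \<notin> B}) = real (card ?D) - real l" if e: "e \<in> E - F" for e
  proof -
    have "blocks_through (insert e F) = {B\<in>?D. e \<in> B}" by (auto simp: blocks_through_def)
    then have "card {B\<in>?D. e \<in> B} = l" using l'[OF e] by simp
    moreover have "card ?D = card {B\<in>?D. e \<in> B} + card {B\<in>?D. e \<notin> B}"
      by (subst card_Un_disjoint[symmetric]) (use finite_blocks_through in \<open>auto intro: arg_cong[of _ _ card]\<close>)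
    ultimately show ?thesis by simp
  qed
  have "real (card ?D) \<le> (\<Sum>B\<in>?D. \<Sum>e\<in>E - B. y e)"
    using sum_mono[of ?D "\<lambda>_. 1" "\<lambda>B. \<Sum>e\<in>E - B. y e"] y by (simp add: blocks_through_def)
  also have "\<dots> = (\<Sum>B\<in>?D. \<Sum>e\<in>{e\<in>E - F. e \<notin> B}. y e)"
    by (intro sum.cong refl) (auto simp: blocks_through_def)
  also have "\<dots> = (\<Sum>e\<in>E - F. \<Sum>B\<in>{B\<in>?D. e \<notin> B}. y e)"
    by (rule sum.swap_restrict[OF finite_blocks_through]) (use fin in auto)
  also have "\<dots> = (\<Sum>e\<in>E - F. (real (card ?D) - real l) * y e)"
    by (intro sum.cong refl) (use miss in simp)
  also have "\<dots> = (real (card ?D) - real l) * (\<Sum>e\<in>E - F. y e)" by (simp add: sum_distrib_left)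
  finally have *: "real (card ?D) \<le> (real (card ?D) - real l) * (\<Sum>e\<in>E - F. y e)" .
  have jk: "?j \<le> k" "?j \<le> n" "k \<le> n" using F(2) t_less k_less by auto
  have cr: "real (card ?D) * (real k - real ?j) = (real n - real ?j) * real l"
    using arg_cong[OF count, of real] jk by (simp add: of_nat_diff)
  have "real (card ?D) * real (n - ?j) \<le> (real n - real ?j) * ((real (card ?D) - real l) * (\<Sum>e\<in>E - F. y e))"
    using mult_left_mono[OF *, of "real n - real ?j"] jk by (simp add: of_nat_diff mult.commute)
  also have "\<dots> = ((real n - real ?j) * real (card ?D) - (real n - real ?j) * real l) * (\<Sum>e\<in>E - F. y e)"
    by (simp add: algebra_simps)
  also have "\<dots> = real (card ?D) * (real (n - k) * (\<Sum>e\<in>E - F. y e))"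
    unfolding cr[symmetric] using jk by (simp add: of_nat_diff algebra_simps)
  finally show ?thesis using D_pos by simp
qed

text \<open>For \<open>k = t + x\<close> the codimension is at least \<open>x + 1\<close>, and
  \<open>t * (x + 1) \<ge> t + x\<close>.\<close>

lemma t_mult_codim_ge: "k \<le> t * (n - k)"
proof -
  have "k \<le> t * (k - t + 1)"
  proof -
    obtain x where "k = t + x" using t_less less_imp_add_positive by blast
    moreover have "x \<le> t * x" using t_pos by simp
    ultimately show ?thesis by simp
  qed
  also have "\<dots> \<le> t * (n - k)" using codim_ge by (rule mult_le_mono2)
  finally show ?thesis .
qed

section \<open>Bases of the matroid and sets meeting all of them\<close>

abbreviation Bs :: "'e set set" where
  "Bs \<equiv> {B. B \<subseteq> E \<and> card B = k \<and> B \<notin> Bl}"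

lemma transversal_block:
  assumes "B \<in> Bl" "A \<in> Bs"
  shows "A \<inter> (E - B) \<noteq> {}"
proof
  assume "A \<inter> (E - B) = {}"
  then have "A \<subseteq> B" using assms(2) by auto
  then have "A = B" using card_subset_eq[OF finite_block] assms card_block by auto
  then show False using assms by simp
qed

lemma transversal_small:
  assumes "card G < k" "G \<subseteq> E" "A \<in> Bs"
  shows "A \<inter> (E - G) \<noteq> {}"
proof
  assume "A \<inter> (E - G) = {}"
  then have "A \<subseteq> G" using assms(3) by auto
  moreover have "finite G" using assms(2) fin finite_subset by auto
  ultimately show False using card_mono[of G A] assms by simp
qed

text \<open>Two distinct \<open>k\<close>-subsets of a \<open>(k + 1)\<close>-set share
  \<open>k - 1 \<ge> t\<close> points and therefore cannot both be blocks.\<close>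

lemma ex_basis_subset:
  assumes "X \<subseteq> E" "k < card X"
  shows "\<exists>A\<in>Bs. A \<subseteq> X"
proof (rule ccontr)
  assume none: "\<not> ?thesis"
  obtain T where T: "T \<subseteq> X" "card T = Suc k" "finite T"
    using obtain_subset_with_card_n[of "Suc k" X] assms(2) by auto
  then have "2 \<le> card T" using t_less by simp
  then obtain x y where xy: "x \<in> T" "y \<in> T" "x \<noteq> y"
    by (metis T(3) card_le_Suc0_iff_eq not_less_eq_eq numeral_2_eq_2)
  have bl: "T - {z} \<in> Bl" if "z \<in> T" for z
  proof -
    have "T - {z} \<subseteq> E" "card (T - {z}) = k" "T - {z} \<subseteq> X" using T assms(1) that by auto
    then show ?thesis using none by blast
  qed
  have "card (T - {x, y}) = k - 1" using T xy by (simp add: card_Diff_subset)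
  then have "T - {x} = T - {y}"
    using t_less by (intro block_unique[OF bl[OF xy(1)] bl[OF xy(2)], of "T - {x, y}"]) auto
  then show False using xy by blast
qed

lemma codim_real: "real (n - k) = real n - real k"
  using k_less by simp

section \<open>The width-length inequality for bases and cocircuits\<close>

context
  fixes y :: "'e \<Rightarrow> real"
  assumes y_nonneg: "\<And>e. 0 \<le> y e"
    and y_cover: "\<And>C. C \<in> blocker E Bs \<Longrightarrow> 1 \<le> (\<Sum>e\<in>C. y e)"
begin

lemma transversal_weight:
  assumes "T \<subseteq> E" "\<And>A. A \<in> Bs \<Longrightarrow> A \<inter> T \<noteq> {}"
  shows "1 \<le> (\<Sum>e\<in>T. y e)"
proof -
  obtain C where C: "C \<in> blocker E Bs" "C \<subseteq> T" using ex_blocker_subset[OF fin assms] by blast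
  have "1 \<le> (\<Sum>e\<in>C. y e)" by (rule y_cover[OF C(1)])
  also have "\<dots> \<le> (\<Sum>e\<in>T. y e)"
    using C(2) fin assms(1) finite_subset y_nonneg by (intro sum_mono2) auto
  finally show ?thesis .
qed

lemma block_weight: "B \<in> Bl \<Longrightarrow> 1 \<le> (\<Sum>e\<in>E - B. y e)"
  using transversal_block by (intro transversal_weight) auto

lemma small_weight: "G \<subseteq> E \<Longrightarrow> card G < k \<Longrightarrow> 1 \<le> (\<Sum>e\<in>E - G. y e)"
  using transversal_small by (intro transversal_weight) auto

text \<open>These are the tail bounds for the Abel summation. The cases are \<open>j < t\<close>,
  \<open>F\<close> inside a block, and \<open>F\<close> inside no block; each ends in a polynomial
  inequality in \<open>j\<close>, \<open>a\<close> and \<open>m\<close>, where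
  \<open>k = j + a\<close> and \<open>n = m + k\<close>.\<close>

lemma flat_weight:
  assumes F: "F \<subseteq> E" and j: "card F < k"
  shows "real (k - card F) * real n \<le> real k * real (n - k) * (\<Sum>e\<in>E - F. y e)"
proof -
  define j where "j = card F"
  define a where "a = k - j"
  define m where "m = n - k"
  define Y where "Y = (\<Sum>e\<in>E - F. y e)"
  have finF: "finite F" using F fin finite_subset by blast
  have k_eq: "k = j + a" and a: "1 \<le> a" using j by (auto simp: j_def a_def)
  have n_eq: "n = m + k" using k_less by (simp add: m_def)
  have m: "k - t + 1 \<le> m" using codim_ge by (simp add: m_def)
  have cEF: "card (E - F) = m + a"
    using card_Diff_subset[OF finF F] card_E n_eq k_eq by (simp add: j_def)
  text \<open>Removing a heavy set \<open>A\<close> of \<open>a - 1\<close> elements leaves the complement of a \<open>(k-1)\<close>-subset.\<close>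
  have remove: "1 + (\<Sum>e\<in>A. y e) \<le> Y" if A: "A \<subseteq> E - F" "card A = a - 1" for A
  proof -
    have finA: "finite A" using A fin finite_subset by blast
    have "card (F \<union> A) = k - 1" using A finF finA a k_eq by (subst card_Un_disjoint) (auto simp: j_def)
    then have "1 \<le> (\<Sum>e\<in>E - (F \<union> A). y e)" using F A a k_eq by (intro small_weight) auto
    moreover have "Y = (\<Sum>e\<in>(E - F) - A. y e) + (\<Sum>e\<in>A. y e)"
      unfolding Y_def using A fin by (intro sum.subset_diff) auto
    moreover have "(E - F) - A = E - (F \<union> A)" by blast
    ultimately show ?thesis by simp
  qed
  have "real a * real n \<le> real k * real m * Y"
  proof (cases "j < t")
    case True
    then have *: "real (n - j) \<le> real m * Y"
      using design_bound[OF F _ block_weight] by (simp add: j_def m_def Y_def)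
    \<comment> \<open>With \<open>n - j = m + a\<close> this reduces to
      \<open>a * m \<le> k * m\<close>.\<close>
    have "a * n \<le> k * (n - j)"
    proof -
      have "n - j = m + a" using n_eq k_eq by simp
      then show ?thesis using n_eq k_eq by (simp add: algebra_simps)
    qed
    then have "real a * real n \<le> real k * real (n - j)"
      unfolding of_nat_mult[symmetric] of_nat_le_iff .
    also have "\<dots> \<le> real k * (real m * Y)" using * by (rule mult_left_mono) simp
    finally show ?thesis by (simp add: mult.assoc)
  next
    case False
    show ?thesis
    proof (cases "\<exists>B\<in>Bl. F \<subseteq> B")
      case True
      then obtain B where B: "B \<in> Bl" "F \<subseteq> B" by blast
      have cEB: "card (E - B) = m"
        using card_Diff_subset[OF finite_block block_subset] B card_block card_E by (simp add: m_def)
      \<comment> \<open>There is room for \<open>A\<close> outside the block: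
        \<open>j \<ge> t\<close> gives \<open>a \<le> k - t < m\<close>.\<close>
      have "a - 1 \<le> card (E - B)" using cEB m False k_eq by linarith
      then obtain A where A: "A \<subseteq> E - B" "card A = a - 1"
        and heavy: "real (a - 1) * (\<Sum>e\<in>E - B. y e) \<le> real (card (E - B)) * (\<Sum>e\<in>A. y e)"
        using ex_heavy_subset[of "E - B" "a - 1" y] fin by auto
      have "1 + (\<Sum>e\<in>A. y e) \<le> Y" using A B by (intro remove) auto
      \<comment> \<open>The complement of the block has \<open>m\<close> elements and weight at
        least \<open>1\<close>, so \<open>A\<close> has weight at least
        \<open>(a - 1) / m\<close>.\<close>
      have "real (a - 1) * 1 \<le> real (a - 1) * (\<Sum>e\<in>E - B. y e)"
        by (rule mult_left_mono[OF block_weight[OF B(1)]]) simp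
      also have "\<dots> \<le> real m * (\<Sum>e\<in>A. y e)" using heavy cEB by simp
      also have "\<dots> \<le> real m * (Y - 1)"
        using \<open>1 + (\<Sum>e\<in>A. y e) \<le> Y\<close> by (intro mult_left_mono) auto
      finally have mY: "real m + real a - 1 \<le> real m * Y" using a by (simp add: of_nat_diff algebra_simps)
      have "k \<le> j * m"
        using order_trans[OF t_mult_codim_ge mult_le_mono1[of t j]] False by (simp add: m_def)
      then have jm: "real k \<le> real j * real m" unfolding of_nat_mult[symmetric] of_nat_le_iff .
      have "real k * (real m + real a - 1) - real a * real n = real j * real m - real k"
        unfolding n_eq of_nat_add by (simp add: k_eq algebra_simps)
      then have "real a * real n \<le> real k * (real m + real a - 1)" using jm by simp
      also have "\<dots> \<le> real k * (real m * Y)" using mY by (rule mult_left_mono) simp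
      finally show ?thesis by (simp add: mult.assoc)
    next
      case nb: False
      \<comment> \<open>A set of at most \<open>t\<close> points would lie in a block. The strict
        inequality gives the extra room used in the final estimate.\<close>
      then have "t < j" using ex_block[OF F] False by (force simp: j_def)
      have "a - 1 \<le> card (E - F)" using cEF by simp
      then obtain A where A: "A \<subseteq> E - F" "card A = a - 1"
        and heavy: "real (a - 1) * Y \<le> real (m + a) * (\<Sum>e\<in>A. y e)"
        using ex_heavy_subset[of "E - F" "a - 1" y] fin unfolding Y_def cEF by blast
      have "1 + (\<Sum>e\<in>A. y e) \<le> Y" using A by (intro remove) auto
      then have "real (m + a) * (1 + (\<Sum>e\<in>A. y e)) \<le> real (m + a) * Y" by (rule mult_left_mono) simp
      \<comment> \<open>Here \<open>A\<close> is heavy relative to all of \<open>E - F\<close>, so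
        \<open>Y\<close> occurs on both sides:
        \<open>Y \<ge> 1 + (a - 1) * Y / (m + a)\<close>.\<close>
      then have Y: "real (m + a) \<le> real (m + 1) * Y"
        using heavy a by (simp add: of_nat_diff algebra_simps)
      have "2 \<le> j" "a + 2 \<le> m" using \<open>t < j\<close> t_pos m k_eq by linarith+
      \<comment> \<open>Slack variables for the two bounds. After substitution the difference of the
        two sides of the next inequality is a polynomial with nonnegative coefficients.\<close>
      then obtain w x where w: "j = 2 + w" and x: "m = a + 2 + x" by (meson le_Suc_ex)
      have "a * n * (m + 1) \<le> k * m * (m + a)"
        unfolding n_eq k_eq w x by (simp add: algebra_simps)
      then have "real a * real n * real (m + 1) \<le> real k * real m * real (m + a)"
        unfolding of_nat_mult[symmetric] of_nat_le_iff .
      also have "\<dots> \<le> real k * real m * (real (m + 1) * Y)" using Y by (rule mult_left_mono) simp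
      finally have "real (m + 1) * (real a * real n) \<le> real (m + 1) * (real k * real m * Y)"
        by (simp only: mult_ac)
      then show ?thesis by (subst (asm) mult_le_cancel_left_pos) auto
    qed
  qed
  then show ?thesis by (simp add: a_def j_def m_def Y_def)
qed

text \<open>The greedy basis consists of the \<open>k\<close> elements with smallest
  \<open>z\<close>, or, if these form a block, of the first \<open>k - 1\<close> and the
  \<open>(k + 1)\<close>-st. Abel summation bounds \<open>\<Sum>e\<in>E. y e * z e\<close> below by
  \<open>q\<close> times the \<open>z\<close>-weight of this basis, which is at least
  \<open>1\<close>.\<close>

lemma basis_width_length:
  assumes z_nonneg: "\<And>e. 0 \<le> z e" and z_cover: "\<And>A. A \<in> Bs \<Longrightarrow> 1 \<le> (\<Sum>e\<in>A. z e)"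
  shows "real n / (real k * real (n - k)) \<le> (\<Sum>e\<in>E. y e * z e)"
proof -
  define q where "q = real n / (real k * real (n - k))"
  have km: "0 < real k * real (n - k)" using t_less k_less by simp
  have q_pos: "0 \<le> q" using km by (simp add: q_def)
  have tail: "q * real (k - card F) \<le> (\<Sum>e\<in>E - F. y e)" if "F \<subseteq> E" "card F < k" for F
  proof -
    have "real (k - card F) * real n / (real k * real (n - k)) \<le> (\<Sum>e\<in>E - F. y e)"
      unfolding pos_divide_le_eq[OF km] using flat_weight[OF that] by (simp only: mult.commute)
    then show ?thesis unfolding q_def times_divide_eq_left by (simp only: mult.commute)
  qed
  \<comment> \<open>Used when the greedy basis skips an element: one basis element then lies beyond
    the first \<open>k\<close>, where the tail weight is only known to be at least
    \<open>1\<close>.\<close>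
  have q_le: "q \<le> 1"
  proof -
    have "n \<le> k * (n - k)"
    proof -
      have "2 \<le> n - k" "2 \<le> k" using codim_ge t_less t_pos by linarith+
      then obtain m' k' where m': "n - k = 2 + m'" and k': "k = 2 + k'" by (meson le_Suc_ex)
      then have "n = 2 + m' + (2 + k')" using k_less by simp
      then show ?thesis unfolding m' by (simp add: k')
    qed
    then have "real n \<le> real k * real (n - k)" unfolding of_nat_mult[symmetric] of_nat_le_iff .
    then show ?thesis unfolding q_def pos_divide_le_eq[OF km] by (simp only: mult_1)
  qed
  obtain xs0 where "set xs0 = E" "distinct xs0" using finite_distinct_list[OF fin] by blast
  define xs where "xs = sort_key z xs0"
  have xs: "set xs = E" "distinct xs" "sorted (map z xs)"
    using \<open>set xs0 = E\<close> \<open>distinct xs0\<close> by (simp_all add: xs_def)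
  have len: "length xs = n" using distinct_card[OF xs(2)] xs(1) card_E by simp
  define F where "F i = set (take i xs)" for i
  have FE: "F i \<subseteq> E" for i using xs(1) set_take_subset[of i xs] by (simp add: F_def)
  have cF: "card (F i) = i" if "i \<le> n" for i
    using distinct_card[OF distinct_take[OF xs(2)], of i] that len by (simp add: F_def)
  have F_mono: "F i \<subseteq> F j" if "i \<le> j" for i j
    unfolding F_def using that by (rule set_take_subset_set_take)
  have drop: "set (drop i xs) = E - F i" for i
    using xs(1,2) set_drop_subset[of i xs] set_take_disj_set_drop_if_distinct[OF xs(2), of i i]
      append_take_drop_id[of i xs] unfolding F_def
    by (metis Diff_Un Diff_triv Int_commute Un_Diff_cancel2 Un_Diff set_append sup_bot.left_neutral Diff_cancel order_refl)
  have finB: "finite B" if "B \<subseteq> E" for B using that fin finite_subset by blast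
  have conclude: "q \<le> (\<Sum>e\<in>E. y e * z e)"
    if B: "B \<in> Bs" and BF: "\<And>i. i \<le> n \<Longrightarrow> q * real (card (B - F i)) \<le> (\<Sum>e\<in>E - F i. y e)" for B
  proof -
    \<comment> \<open>The assumption \<open>BF\<close> says precisely that the tail sums of this
      difference are nonnegative.\<close>
    let ?d = "\<lambda>e. y e - q * of_bool (e \<in> B)"
    have sum_d: "sum_list (map ?d (drop i xs)) = (\<Sum>e\<in>E - F i. y e) - q * real (card (B - F i))" for i
    proof -
      have "sum_list (map ?d (drop i xs)) = (\<Sum>e\<in>E - F i. ?d e)"
        using xs(2) by (subst sum_list_distinct_conv_sum_set) (simp_all add: drop)
      moreover have "(\<Sum>e\<in>E - F i. of_bool (e \<in> B)) = real (card (B - F i))"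
      proof -
        have "(E - F i) \<inter> B = B - F i" using B by blast
        then show ?thesis using fin by (simp add: of_bool_def sum.If_cases)
      qed
      ultimately show ?thesis by (simp add: sum_subtractf sum_distrib_left[symmetric])
    qed
    have tails: "0 \<le> sum_list (map ?d (drop i xs))" for i
    proof (cases "i \<le> n")
      case True
      then show ?thesis using BF by (simp add: sum_d)
    next
      case False
      then show ?thesis using len by simp
    qed
    have "0 * sum_list (map ?d xs) \<le> sum_list (map (\<lambda>e. ?d e * z e) xs)"
      by (rule sorted_tail_sums_le[OF xs(3) tails]) (rule z_nonneg)
    also have "\<dots> = (\<Sum>e\<in>E. ?d e * z e)" using xs by (simp add: sum_list_distinct_conv_sum_set)
    also have "\<dots> = (\<Sum>e\<in>E. y e * z e) - q * (\<Sum>e\<in>E. of_bool (e \<in> B) * z e)"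
      by (simp add: left_diff_distrib sum_subtractf sum_distrib_left mult.assoc)
    also have "(\<Sum>e\<in>E. of_bool (e \<in> B) * z e) = (\<Sum>e\<in>B. z e)"
    proof -
      have "(\<Sum>e\<in>E. of_bool (e \<in> B) * z e) = (\<Sum>e\<in>B. of_bool (e \<in> B) * z e)"
        by (rule sum.mono_neutral_right) (use fin B in auto)
      then show ?thesis by simp
    qed
    finally have "q * (\<Sum>e\<in>B. z e) \<le> (\<Sum>e\<in>E. y e * z e)" by simp
    moreover have "q * 1 \<le> q * (\<Sum>e\<in>B. z e)" using z_cover[OF B] q_pos by (rule mult_left_mono)
    ultimately show ?thesis by simp
  qed
  have diff_card: "card (B - F i) = k - i" if "F i \<subseteq> B" "card B = k" "i \<le> n" for B i
    using that card_Diff_subset[of "F i" B] cF by (simp add: F_def)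
  have "q \<le> (\<Sum>e\<in>E. y e * z e)"
  proof (cases "F k \<in> Bl")
    case False
    show ?thesis
    proof (rule conclude)
      show "F k \<in> Bs" using False FE cF k_less by simp
      fix i assume i: "i \<le> n"
      show "q * real (card (F k - F i)) \<le> (\<Sum>e\<in>E - F i. y e)"
      proof (cases "i < k")
        case True
        then show ?thesis using diff_card[OF F_mono] tail[OF FE, of i] cF i k_less by simp
      next
        case False
        then have empty: "F k - F i = {}" using F_mono[of k i] by simp
        show ?thesis unfolding empty using y_nonneg by (simp add: sum_nonneg)
      qed
    qed
  next
    case True
    \<comment> \<open>Indices start at \<open>0\<close>, so this is the \<open>(k + 1)\<close>-st
      element. It replaces the \<open>k\<close>-th one, since the first \<open>k\<close> elements
      form a block.\<close>
    define x where "x = xs ! k"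
    have xk: "F (Suc k) = insert x (F k)" using len k_less by (simp add: F_def x_def take_Suc_conv_app_nth)
    have k1: "Suc (k - 1) = k" using t_less by simp
    have x: "x \<notin> F k"
    proof
      assume "x \<in> F k"
      then have "F (Suc k) = F k" using xk by (simp add: insert_absorb)
      then show False using cF[of k] cF[of "Suc k"] k_less by simp
    qed
    define B where "B = insert x (F (k - 1))"
    have sub: "F (k - 1) \<subseteq> F k" by (rule F_mono) simp
    have BE: "B \<subseteq> E" using FE xk by (metis B_def insert_subset order_trans subset_insertI)
    have cB: "card B = k"
      using x sub cF[of "k - 1"] k_less k1 finB[OF FE] by (subst B_def, subst card_insert_disjoint) auto
    \<comment> \<open>\<open>B\<close> shares the \<open>k - 1 \<ge> t\<close> points of
      \<open>F (k - 1)\<close> with the block \<open>F k\<close> but differs from it.\<close>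
    have "B \<notin> Bl"
    proof
      assume "B \<in> Bl"
      then have "B = F k"
        using cF[of "k - 1"] k_less t_less sub
        by (intro block_unique[OF _ True, of B "F (k - 1)"]) (auto simp: B_def)
      then show False using x by (auto simp: B_def)
    qed
    show ?thesis
    proof (rule conclude)
      show "B \<in> Bs" using BE cB \<open>B \<notin> Bl\<close> by simp
      fix i assume i: "i \<le> n"
      consider "i < k" | "i = k" | "k < i" by linarith
      then show "q * real (card (B - F i)) \<le> (\<Sum>e\<in>E - F i. y e)"
      proof cases
        case 1
        then have "F i \<subseteq> F (k - 1)" by (intro F_mono) simp
        then have "F i \<subseteq> B" unfolding B_def by blast
        then show ?thesis using 1 diff_card[OF _ cB i] tail[OF FE, of i] cF[OF i] by simp
      next
        \<comment> \<open>Here \<open>tail\<close> does not apply because \<open>F i\<close> has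
          \<open>k\<close> elements; instead \<open>F i\<close> is a block, whose complement has
          weight at least \<open>1\<close>.\<close>
        case 2
        have single: "B - F i = {x}" using 2 x sub by (auto simp: B_def)
        show ?thesis unfolding single using q_le block_weight[OF True] 2 by simp
      next
        case 3
        then have "F (Suc k) \<subseteq> F i" by (intro F_mono) simp
        then have "B \<subseteq> F i" using xk sub unfolding B_def by blast
        then have empty: "B - F i = {}" by blast
        show ?thesis unfolding empty using y_nonneg by (simp add: sum_nonneg)
      qed
    qed
  qed
  then show ?thesis by (simp add: q_def)
qed

end

section \<open>Sizes of cocircuits and the two paired clutters\<close>

lemma cocircuit_card_ge:
  assumes C: "C \<in> blocker E Bs"
  shows "n - k \<le> card C"
proof (rule ccontr)
  assume "\<not> ?thesis"
  moreover have CE: "C \<subseteq> E" using C by (simp add: blocker_def)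
  moreover have "card (E - C) = n - card C"
    using card_Diff_subset[OF finite_subset[OF CE fin] CE] card_E by simp
  ultimately have "k < card (E - C)" by simp
  \<comment> \<open>Too small a cocircuit would have a complement of more than \<open>k\<close>
    elements, hence a basis disjoint from it.\<close>
  then obtain A where A: "A \<in> Bs" "A \<subseteq> E - C" using ex_basis_subset[of "E - C"] by blast
  then show False using blocker_meets[OF C A(1)] by blast
qed

text \<open>The complement of a block meets every basis and has \<open>n - k\<close> elements, the
  least possible size of a cocircuit.\<close>

lemma ex_cocircuit_card: "\<exists>C\<in>blocker E Bs. card C = n - k"
proof -
  obtain B where B: "B \<in> Bl" using ex_block[of "{}"] by auto
  have c: "card (E - B) = n - k"
    using card_Diff_subset[OF finite_block block_subset] B card_block card_E by simp
  obtain C where C: "C \<in> blocker E Bs" "C \<subseteq> E - B"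
    using ex_blocker_subset[OF fin, of "E - B" Bs] transversal_block[OF B] by auto
  have "card C \<le> n - k" using card_mono[OF _ C(2)] fin c by simp
  then show ?thesis using C(1) cocircuit_card_ge[OF C(1)] by (meson le_antisym)
qed

lemma blocker_blocker_Bs: "blocker E (blocker E Bs) = Bs"
proof (rule blocker_blocker[OF fin])
  fix A B assume "A \<in> Bs" "B \<in> Bs" "A \<subseteq> B"
  then show "A = B" using card_subset_eq[of B A] fin finite_subset by auto
qed auto

lemma paired_bases: "paired_clutter E Bs k (n - k)"
proof
  show "\<exists>A\<in>Bs. card A = k"
    using ex_basis_subset[of E] card_E k_less by auto
  fix y z :: "'e \<Rightarrow> real"
  assume "\<And>e. 0 \<le> y e" "\<And>e. 0 \<le> z e" "\<And>C. C \<in> blocker E Bs \<Longrightarrow> 1 \<le> sum y C" "\<And>A. A \<in> Bs \<Longrightarrow> 1 \<le> sum z A"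
  then show "real (card E) / (real k * real (n - k)) \<le> (\<Sum>e\<in>E. y e * z e)"
    unfolding card_E by (intro basis_width_length)
qed (use fin t_less k_less cocircuit_card_ge in auto)

text \<open>The blocker of the cocircuits is the set of bases again, so the same inequality serves
  with the roles of \<open>y\<close> and \<open>z\<close> exchanged.\<close>

lemma paired_cocircuits: "paired_clutter E (blocker E Bs) (n - k) k"
proof
  show "blocker E Bs \<subseteq> Pow E" by (auto simp: blocker_def)
  show "\<exists>A\<in>blocker E Bs. card A = n - k" by (rule ex_cocircuit_card)
  show "k \<le> card C" if "C \<in> blocker E (blocker E Bs)" for C using that unfolding blocker_blocker_Bs by simp
  fix y z :: "'e \<Rightarrow> real"
  assume "\<And>e. 0 \<le> y e" "\<And>e. 0 \<le> z e" "\<And>C. C \<in> blocker E (blocker E Bs) \<Longrightarrow> 1 \<le> sum y C"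
    "\<And>A. A \<in> blocker E Bs \<Longrightarrow> 1 \<le> sum z A"
  then have "real n / (real k * real (n - k)) \<le> (\<Sum>e\<in>E. z e * y e)"
    unfolding blocker_blocker_Bs by (intro basis_width_length)
  then show "real (card E) / (real (n - k) * real k) \<le> (\<Sum>e\<in>E. y e * z e)"
    by (simp add: card_E mult.commute)
qed (use fin t_less k_less cocircuit_card_ge in auto)

end

theorem theorem7p6:
  fixes K :: "'k::field itself"
    and E :: "'e set" and Bl :: "'e set set"
    and t k n :: nat
  assumes "steiner_system t k n E Bl"
    and "1 \<le> t" and "t < k" and "k < n"
  defines "R \<equiv> poly_ring K E"
    and "I \<equiv> facet_ideal K (steiner_matroid k E Bl)"
    and "J \<equiv> stanley_reisner_ideal K (dual_matroid (steiner_matroid k E Bl))"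
  shows "asymptotic_resurgence R I = real (initial_degree I) / waldschmidt R I
       \<and> real (initial_degree I) / waldschmidt R I = real k * (real n - real k) / real n
       \<and> real k * (real n - real k) / real n = real (initial_degree J) / waldschmidt R J
       \<and> real (initial_degree J) / waldschmidt R J = asymptotic_resurgence R J"
proof -
  interpret steiner t k n E Bl by (rule steiner.intro) fact+
  interpret b: paired_clutter E Bs k "n - k" by (rule paired_bases)
  interpret c: paired_clutter E "blocker E Bs" "n - k" k by (rule paired_cocircuits)
  have ground: "ground (steiner_matroid k E Bl) = E" "bases (steiner_matroid k E Bl) = Bs"
    by (simp_all add: steiner_matroid_def)
  have I: "I = b.I"
    unfolding I_def facet_ideal_def ground by (rule genideal_sqfree_monom[OF fin b.sub])
  \<comment> \<open>The circuits of the dual are the minimal transversals of the bases, so this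
    ideal is the squarefree ideal of the blocker of \<open>Bs\<close>.\<close>
  have J: "J = c.I"
    unfolding J_def stanley_reisner_ideal_def circuits_dual_matroid ground
    using genideal_sqfree_monom[OF fin c.sub, of K] by (simp add: dual_matroid_def ground)
  have n: "0 < real n" "0 < real n - real k" "0 < real k" using t_less k_less by auto
  show ?thesis
    unfolding I J R_def b.asymptotic_resurgence_I c.asymptotic_resurgence_I b.waldschmidt_I c.waldschmidt_I
      b.initial_degree_I c.initial_degree_I card_E codim_real
    using n by (simp add: mult.commute)
qed

end
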